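(* Let $d\geq 1$ be fixed. There is a deterministic online algorithm for online TSP in $\mathbb{R}^d$ (with the Euclidean distance) whose competitive ratio is $\sqrt{d}\cdot 2^d\cdot O(\sqrt{n\log n})$.
   Context: Online TSP in a metric space $(S,\mathrm{dist})$: a sequence $X=(x_1,\dots,x_n)$ of points of $S$ (repetitions allowed) is revealed one at a time. An online algorithm maintains an array $A[1],\dots,A[n]$ of initially empty cells; upon receiving $x_j$ it must immediately and irrevocably write $x_j$ into some previously empty cell. The cost of the final array is $\sum_{i=1}^{n-1}\mathrm{dist}(A[i],A[i+1])$. $\mathtt{OPT}(X)$ is the minimum of this cost over all bijective placements of the items into the cells. The competitive ratio of an algorithm $\mathcal A$ is the supremum over inputs $X$ of size $n$ of $\mathcal A(X)/\mathtt{OPT}(X)$, where $\mathcal A(X)$ is its cost on $X$. *)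

theory Defs
  imports "HOL-Analysis.Analysis" "HOL-Library.Landau_Symbols" "HOL-Combinatorics.Permutations"
begin

text \<open>
  \<open>\<real>\<^sup>d\<close> is carried by the set of \<open>Euclidean_space d\<close> (sequences that vanish from index \<open>d\<close> on),
  so that the dimension is a term and one constant can serve all dimensions.
\<close>

definition Rn_metric :: "nat \<Rightarrow> (nat \<Rightarrow> real) metric" where
  "Rn_metric d = metric (topspace (Euclidean_space d), \<lambda>x y. L2_set (\<lambda>i. x i - y i) {..<d})"

lemma Metric_space_Rn:
  "Metric_space (topspace (Euclidean_space d)) (\<lambda>x y. L2_set (\<lambda>i. x i - y i) {..<d})"
proof
  fix x y z :: "nat \<Rightarrow> real"
  show "0 \<le> L2_set (\<lambda>i. x i - y i) {..<d}"
    by (rule L2_set_nonneg)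
  show "L2_set (\<lambda>i. x i - y i) {..<d} = L2_set (\<lambda>i. y i - x i) {..<d}"
    by (simp add: L2_set_def power2_commute)
  assume x: "x \<in> topspace (Euclidean_space d)" and y: "y \<in> topspace (Euclidean_space d)"
  show "L2_set (\<lambda>i. x i - y i) {..<d} = 0 \<longleftrightarrow> x = y"
  proof
    assume "L2_set (\<lambda>i. x i - y i) {..<d} = 0"
    then have lt: "\<forall>i<d. x i = y i"
      by (auto simp: L2_set_eq_0_iff)
    have "x i = y i" for i
      using lt x y by (cases "i < d") (auto simp: topspace_Euclidean_space)
    then show "x = y" by blast
  qed (simp add: L2_set_def)
  show "L2_set (\<lambda>i. x i - z i) {..<d}
        \<le> L2_set (\<lambda>i. x i - y i) {..<d} + L2_set (\<lambda>i. y i - z i) {..<d}"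
    using L2_set_triangle_ineq[of "\<lambda>i. x i - y i" "\<lambda>i. y i - z i" "{..<d}"] by simp
qed

lemma mspace_Rn_metric [simp]: "mspace (Rn_metric d) = topspace (Euclidean_space d)"
  by (simp add: Rn_metric_def Metric_space.mspace_metric[OF Metric_space_Rn])

lemma mdist_Rn_metric [simp]: "mdist (Rn_metric d) x y = L2_set (\<lambda>i. x i - y i) {..<d}"
  by (simp add: Rn_metric_def Metric_space.mdist_metric[OF Metric_space_Rn])

text \<open>
  Items and cells are numbered \<open>0, \<dots>, n - 1\<close>.  A deterministic online algorithm is a function that,
  given the array size \<open>n\<close> and the items revealed so far, returns the cell for the last of them.
\<close>

type_synonym 'a online_alg = "nat \<Rightarrow> 'a list \<Rightarrow> nat"

definition tsp_inputs :: "'a metric \<Rightarrow> nat \<Rightarrow> 'a list set" where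
  "tsp_inputs m n = {X. set X \<subseteq> mspace m \<and> length X = n}"

definition alg_cell :: "'a online_alg \<Rightarrow> 'a list \<Rightarrow> nat \<Rightarrow> nat" where
  "alg_cell alg X j = alg (length X) (take (Suc j) X)"

definition online_algorithm :: "'a metric \<Rightarrow> 'a online_alg \<Rightarrow> bool" where
  "online_algorithm m alg \<longleftrightarrow>
     (\<forall>n. \<forall>X\<in>tsp_inputs m n. \<forall>j<n.
        alg_cell alg X j < n \<and> (\<forall>k<j. alg_cell alg X j \<noteq> alg_cell alg X k))"

text \<open>The array in which item \<open>j\<close> occupies cell \<open>\<pi> j\<close>, for \<open>\<pi>\<close> a bijection of \<open>{..<length X}\<close>.\<close>

definition filled_array :: "'a list \<Rightarrow> (nat \<Rightarrow> nat) \<Rightarrow> nat \<Rightarrow> 'a" where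
  "filled_array X \<pi> i = X ! inv_into {..<length X} \<pi> i"

definition array_cost :: "'a metric \<Rightarrow> nat \<Rightarrow> (nat \<Rightarrow> 'a) \<Rightarrow> real" where
  "array_cost m n A = (\<Sum>i<n - 1. mdist m (A i) (A (Suc i)))"

definition alg_cost :: "'a metric \<Rightarrow> 'a online_alg \<Rightarrow> 'a list \<Rightarrow> real" where
  "alg_cost m alg X = array_cost m (length X) (filled_array X (alg_cell alg X))"

definition tsp_opt :: "'a metric \<Rightarrow> 'a list \<Rightarrow> real" where
  "tsp_opt m X =
     Min ((\<lambda>\<pi>. array_cost m (length X) (filled_array X \<pi>)) ` {\<pi>. \<pi> permutes {..<length X}})"

text \<open>In \<open>ereal\<close>, \<open>0 / 0 = 0\<close> and \<open>c / 0 = \<infinity>\<close> for \<open>c > 0\<close>.\<close>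

definition competitive_ratio :: "'a metric \<Rightarrow> 'a online_alg \<Rightarrow> nat \<Rightarrow> ereal" where
  "competitive_ratio m alg n =
     (SUP X\<in>tsp_inputs m n. ereal (alg_cost m alg X) / ereal (tsp_opt m X))"

end

theory Submission
  imports Defs
begin

text \<open>
  Let \<open>\<tau>\<close> be the length of a shortest walk through the items seen so far, rounded down to a power of
  two, and let \<open>K = sqrt (n / (1 + ln n))\<close>.  Tag every item with \<open>\<tau>\<close> and its cell in the grid of width
  \<open>\<tau> / K\<close>.  A walk of length \<open>2 \<tau>\<close> meets at most \<open>N = 2 ^ d * (2 K + 1)\<close> grid cells, so each scale has at most
  \<open>N\<close> tags.  An item goes directly behind the previous item with its tag if that cell is empty; otherwise
  it goes to the left end of a gap left over from an earlier scale; otherwise it goes to the middle of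
  the longest gap.  Items placed behind their own tag cost \<open>\<tau> sqrt d / K\<close> each.  There are never more than \<open>N\<close> gaps
  when one is split, so splits produce long gaps, and only \<open>O(N log n)\<close> gaps are ever used up.  These account for
  all remaining starts except the first one of each tag, whose costs form a geometric sum over the
  scales.
\<close>

section \<open>Greedy placement into gaps\<close>

text \<open>
  A triple \<open>(a, b, w)\<close> is the maximal run of empty cells \<open>{a..<b}\<close>; \<open>w\<close> is the tag of the item in cell
  \<open>a - 1\<close>.  The first component of a tag is its scale.
\<close>

type_synonym 'k gap = "nat \<times> nat \<times> (real \<times> 'k) option"

text \<open>A gap with owner \<open>None\<close> is live at no scale, so the first item falls under
  the second rule of \<open>choose_cell\<close> and goes to cell 0.\<close>

definition live :: "real \<Rightarrow> 'k gap \<Rightarrow> bool" where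
  "live \<tau> g \<longleftrightarrow> (\<exists>k. snd (snd g) = Some (\<tau>, k))"

definition gap_length :: "'k gap \<Rightarrow> nat" where
  "gap_length g = fst (snd g) - fst g"

definition choose_cell :: "real \<times> 'k \<Rightarrow> 'k gap set \<Rightarrow> 'k gap \<times> nat" where
  "choose_cell c G =
     (if \<exists>g\<in>G. snd (snd g) = Some c
      then (let g = SOME g. g \<in> G \<and> snd (snd g) = Some c in (g, fst g))
      else if \<exists>g\<in>G. \<not> live (fst c) g
      then (let g = SOME g. g \<in> G \<and> \<not> live (fst c) g in (g, fst g))
      else (let g = ARG_MAX gap_length g. g \<in> G in (g, fst g + gap_length g div 2)))"

text \<open>The item in front of the left part is unchanged, so that part keeps its owner; the right
  part now lies behind the new item and passes to its tag.\<close>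

definition split_gap :: "real \<times> 'k \<Rightarrow> 'k gap set \<Rightarrow> 'k gap \<times> nat \<Rightarrow> 'k gap set" where
  "split_gap c G = (\<lambda>((a, b, w), p).
     G - {(a, b, w)} \<union> (if a < p then {(a, p, w)} else {})
       \<union> (if Suc p < b then {(Suc p, b, Some c)} else {}))"

text \<open>Index \<open>t\<close> means after \<open>t\<close> placements, just before item
  \<open>t\<close> arrives.\<close>

primrec gap_state :: "nat \<Rightarrow> (nat \<Rightarrow> real \<times> 'k) \<Rightarrow> nat \<Rightarrow> 'k gap set" where
  "gap_state n c 0 = {(0, n, None)}"
| "gap_state n c (Suc t) = split_gap (c t) (gap_state n c t) (choose_cell (c t) (gap_state n c t))"

declare gap_state.simps(2) [simp del]

definition gap_cell :: "nat \<Rightarrow> (nat \<Rightarrow> real \<times> 'k) \<Rightarrow> nat \<Rightarrow> nat" where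
  "gap_cell n c t = snd (choose_cell (c t) (gap_state n c t))"

lemma gap_state_cong:
  "(\<And>j. j < t \<Longrightarrow> c j = c' j) \<Longrightarrow> gap_state n c t = gap_state n c' t"
proof (induction t)
  case (Suc t)
  then show ?case unfolding gap_state.simps(2) by (metis lessI less_SucI)
qed simp

text \<open>This is what makes the placement online: tags of later items cannot influence a
  cell.\<close>

lemma gap_cell_cong:
  assumes "\<And>j. j \<le> t \<Longrightarrow> c j = c' j"
  shows "gap_cell n c t = gap_cell n c' t"
proof -
  have "gap_state n c t = gap_state n c' t"
    by (rule gap_state_cong) (simp add: assms)
  then show ?thesis by (simp add: gap_cell_def assms)
qed

text \<open>Replaces \<open>SOME\<close> and \<open>ARG_MAX\<close> by the properties they
  guarantee. Each later case also records that the earlier rules did not apply.\<close>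

lemma choose_cell_cases:
  fixes G :: "'k gap set"
  assumes "finite G" "G \<noteq> {}"
  obtains (own) a b where "choose_cell c G = ((a, b, Some c), a)" "(a, b, Some c) \<in> G"
  | (stale) a b w where "choose_cell c G = ((a, b, w), a)" "(a, b, w) \<in> G"
      "\<not> live (fst c) (a, b, w)" "\<And>g. g \<in> G \<Longrightarrow> snd (snd g) \<noteq> Some c"
  | (longest) a b w where "choose_cell c G = ((a, b, w), a + (b - a) div 2)" "(a, b, w) \<in> G"
      "\<And>g. g \<in> G \<Longrightarrow> live (fst c) g" "\<And>g. g \<in> G \<Longrightarrow> snd (snd g) \<noteq> Some c"
      "\<And>g. g \<in> G \<Longrightarrow> gap_length g \<le> b - a"
proof -
  consider (1) "\<exists>g\<in>G. snd (snd g) = Some c"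
    | (2) "\<not> (\<exists>g\<in>G. snd (snd g) = Some c)" "\<exists>g\<in>G. \<not> live (fst c) g"
    | (3) "\<not> (\<exists>g\<in>G. snd (snd g) = Some c)" "\<not> (\<exists>g\<in>G. \<not> live (fst c) g)"
    by blast
  then show thesis
  proof cases
    case 1
    define g where "g = (SOME g. g \<in> G \<and> snd (snd g) = Some c)"
    have "g \<in> G \<and> snd (snd g) = Some c"
      unfolding g_def by (rule someI_ex) (use 1 in blast)
    moreover have "choose_cell c G = (g, fst g)"
      unfolding choose_cell_def g_def[symmetric] using 1 by (simp add: Let_def)
    ultimately show thesis
      using own by (cases g) auto
  next
    case 2
    define g where "g = (SOME g. g \<in> G \<and> \<not> live (fst c) g)"
    have "g \<in> G \<and> \<not> live (fst c) g"
      unfolding g_def by (rule someI_ex) (use 2 in blast)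
    moreover have "choose_cell c G = (g, fst g)"
      unfolding choose_cell_def g_def[symmetric] using 2 by (simp add: Let_def)
    ultimately show thesis
      using stale 2(1) by (cases g) auto
  next
    case 3
    define g where "g = (ARG_MAX gap_length g. g \<in> G)"
    obtain g0 where "g0 \<in> G" using assms(2) by blast
    \<comment> \<open>\<open>arg_max_nat_lemma\<close> asks for a strict upper bound on the lengths;
      finiteness of \<open>G\<close> supplies one.\<close>
    moreover have "gap_length y < Suc (Max (gap_length ` G))" if "y \<in> G" for y
      using assms(1) that by (simp add: less_Suc_eq_le)
    ultimately have max: "g \<in> G \<and> (\<forall>y. y \<in> G \<longrightarrow> gap_length y \<le> gap_length g)"
      unfolding g_def using arg_max_nat_lemma[of "\<lambda>g. g \<in> G" g0 gap_length] by blast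
    have eq: "choose_cell c G = (g, fst g + gap_length g div 2)"
      unfolding choose_cell_def g_def[symmetric] using 3 by (simp add: Let_def)
    obtain a b w where g: "g = (a, b, w)" by (metis prod_cases3)
    have "gap_length g = b - a" by (simp add: g gap_length_def)
    then show thesis
      using longest[of a b w] 3 max eq unfolding g by (metis fst_conv)
  qed
qed

section \<open>Invariant of the gaps during a run\<close>

locale gap_run =
  fixes n :: nat and c :: "nat \<Rightarrow> real \<times> 'k"
begin

abbreviation "gaps \<equiv> gap_state n c"
abbreviation "cell \<equiv> gap_cell n c"

text \<open>The tag condition puts an item with the owner's tag in cell \<open>a - 1\<close>, which
  makes the left end of an own gap a cheap place. The sum counts the empty cells, so some gap exists
  as long as \<open>t < n\<close>.\<close>

definition well_formed :: "nat \<Rightarrow> bool" where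
  "well_formed t \<longleftrightarrow> finite (gaps t)
     \<and> (\<forall>a b w. (a, b, w) \<in> gaps t \<longrightarrow> a < b \<and> b \<le> n \<and> (\<forall>j<t. cell j \<notin> {a..<b})
           \<and> (\<forall>x'. w = Some x' \<longrightarrow> 0 < a \<and> (\<exists>j<t. cell j = a - 1 \<and> c j = x')))
     \<and> (\<forall>g\<in>gaps t. \<forall>h\<in>gaps t. g \<noteq> h \<longrightarrow> {fst g..<fst (snd g)} \<inter> {fst h..<fst (snd h)} = {})
     \<and> (\<Sum>g\<in>gaps t. gap_length g) = n - t"

lemma well_formedD:
  assumes "well_formed t"
  shows "finite (gaps t)"
    and "(a, b, w) \<in> gaps t \<Longrightarrow> a < b"
    and "(a, b, w) \<in> gaps t \<Longrightarrow> b \<le> n"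
    and "(a, b, w) \<in> gaps t \<Longrightarrow> j < t \<Longrightarrow> cell j \<notin> {a..<b}"
    and "(a, b, Some x) \<in> gaps t \<Longrightarrow> 0 < a \<and> (\<exists>j<t. cell j = a - 1 \<and> c j = x)"
    and "(\<Sum>g\<in>gaps t. gap_length g) = n - t"
    and "g \<in> gaps t \<Longrightarrow> h \<in> gaps t \<Longrightarrow> g \<noteq> h \<Longrightarrow>
           {fst g..<fst (snd g)} \<inter> {fst h..<fst (snd h)} = {}"
proof -
  note wf = assms[unfolded well_formed_def]
  note gap = wf[THEN conjunct2, THEN conjunct1, rule_format]
  show "finite (gaps t)" by (rule wf[THEN conjunct1])
  show "(\<Sum>g\<in>gaps t. gap_length g) = n - t"
    by (rule wf[THEN conjunct2, THEN conjunct2, THEN conjunct2])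
  show "g \<in> gaps t \<Longrightarrow> h \<in> gaps t \<Longrightarrow> g \<noteq> h \<Longrightarrow>
           {fst g..<fst (snd g)} \<inter> {fst h..<fst (snd h)} = {}"
    by (rule wf[THEN conjunct2, THEN conjunct2, THEN conjunct1, rule_format])
  show "(a, b, w) \<in> gaps t \<Longrightarrow> a < b" "(a, b, w) \<in> gaps t \<Longrightarrow> b \<le> n"
    "(a, b, w) \<in> gaps t \<Longrightarrow> j < t \<Longrightarrow> cell j \<notin> {a..<b}"
    by (use gap[of a b w] in simp_all)
  show "(a, b, Some x) \<in> gaps t \<Longrightarrow> 0 < a \<and> (\<exists>j<t. cell j = a - 1 \<and> c j = x)"
    by (use gap[of a b "Some x"] in simp)
qed

lemma choice:
  assumes "well_formed t" "t < n"
  obtains a b w where "choose_cell (c t) (gaps t) = ((a, b, w), cell t)" "(a, b, w) \<in> gaps t"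
    "a \<le> cell t" "cell t < b"
proof -
  have "gaps t \<noteq> {}"
    using well_formedD(6)[OF assms(1)] assms(2) by auto
  with well_formedD(1)[OF assms(1)] show thesis
  proof (cases rule: choose_cell_cases[where c = "c t"])
    case (own a b)
    then show thesis using that[of a b "Some (c t)"] well_formedD(2)[OF assms(1)]
      by (auto simp: gap_cell_def)
  next
    case (stale a b w)
    then show thesis using that[of a b w] well_formedD(2)[OF assms(1)]
      by (auto simp: gap_cell_def)
  next
    case (longest a b w)
    have "a < b" using well_formedD(2)[OF assms(1) longest(2)] .
    then have "a + (b - a) div 2 < b" by auto
    with longest show thesis using that[of a b w]
      by (auto simp: gap_cell_def)
  qed
qed

lemma gaps_Suc:
  assumes "choose_cell (c t) (gaps t) = ((a, b, w), p)"
  shows "gaps (Suc t) = gaps t - {(a, b, w)} \<union> (if a < p then {(a, p, w)} else {})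
       \<union> (if Suc p < b then {(Suc p, b, Some (c t))} else {})"
  unfolding gap_state.simps(2) assms by (simp add: split_gap_def)

text \<open>An exact update, because gaps are disjoint and so neither part of the split gap can
  already be in the set. It serves the length sum, the credit and the live count alike.\<close>

lemma sum_gaps_Suc:
  fixes h :: "'k gap \<Rightarrow> real"
  assumes wf: "well_formed t"
    and ch: "choose_cell (c t) (gaps t) = ((a, b, w), p)" and g: "(a, b, w) \<in> gaps t" "a \<le> p" "p < b"
  shows "(\<Sum>g\<in>gaps (Suc t). h g) = (\<Sum>g\<in>gaps t. h g) - h (a, b, w)
     + (if a < p then h (a, p, w) else 0) + (if Suc p < b then h (Suc p, b, Some (c t)) else 0)"
proof -
  let ?G = "gaps t - {(a, b, w)}"
  have new: "(x, y, z) \<notin> ?G" if "a \<le> x" "x < y" "y \<le> b" for x y z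
  proof
    assume "(x, y, z) \<in> ?G"
    then have "{a..<b} \<inter> {x..<y} = {}"
      using well_formedD(7)[OF wf g(1), of "(x, y, z)"] by force
    moreover have "x \<in> {a..<b} \<inter> {x..<y}" using that by auto
    ultimately show False by blast
  qed
  have fin: "finite ?G" using well_formedD(1)[OF wf] by simp
  have "(\<Sum>g\<in>gaps (Suc t). h g) = (\<Sum>g\<in>?G. h g)
     + (if a < p then h (a, p, w) else 0) + (if Suc p < b then h (Suc p, b, Some (c t)) else 0)"
    unfolding gaps_Suc[OF ch] using fin g new[of a p w] new[of "Suc p" b "Some (c t)"]
    by (auto simp: sum.insert_if)
  also have "(\<Sum>g\<in>?G. h g) = (\<Sum>g\<in>gaps t. h g) - h (a, b, w)"
    using sum.remove[OF well_formedD(1)[OF wf] g(1), of h] by simp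
  finally show ?thesis .
qed

lemma well_formed_Suc:
  assumes wf: "well_formed t" and t: "t < n"
  shows "well_formed (Suc t)"
proof -
  obtain a b w where ch: "choose_cell (c t) (gaps t) = ((a, b, w), cell t)"
    and g: "(a, b, w) \<in> gaps t" "a \<le> cell t" "cell t < b"
    using choice[OF assms] .
  note G = gaps_Suc[OF ch]
  note D = well_formedD[OF wf]
  have mem: "(x, y, z) \<in> gaps (Suc t) \<longleftrightarrow> ((x, y, z) \<in> gaps t \<and> (x, y, z) \<noteq> (a, b, w))
     \<or> (a < cell t \<and> x = a \<and> y = cell t \<and> z = w)
     \<or> (Suc (cell t) < b \<and> x = Suc (cell t) \<and> y = b \<and> z = Some (c t))" for x y z
    unfolding G by auto
  have old: "{x..<y} \<inter> {a..<b} = {}" if "(x, y, z) \<in> gaps t" "(x, y, z) \<noteq> (a, b, w)" for x y z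
    using D(7)[OF that(1) g(1) that(2)] by simp
  have p: "cell t \<in> {a..<b}" using g by simp
  show ?thesis
    unfolding well_formed_def
  proof (intro conjI)
    show "finite (gaps (Suc t))" unfolding G using D(1) by simp
    show "\<forall>x y z. (x, y, z) \<in> gaps (Suc t) \<longrightarrow> x < y \<and> y \<le> n \<and> (\<forall>j<Suc t. cell j \<notin> {x..<y})
           \<and> (\<forall>x'. z = Some x' \<longrightarrow> 0 < x \<and> (\<exists>j<Suc t. cell j = x - 1 \<and> c j = x'))"
    proof (intro allI impI)
      fix x y z
      assume "(x, y, z) \<in> gaps (Suc t)"
      then consider (1) "(x, y, z) \<in> gaps t" "(x, y, z) \<noteq> (a, b, w)"
        | (2) "a < cell t" "x = a" "y = cell t" "z = w"
        | (3) "Suc (cell t) < b" "x = Suc (cell t)" "y = b" "z = Some (c t)"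
        unfolding mem by blast
      then show "x < y \<and> y \<le> n \<and> (\<forall>j<Suc t. cell j \<notin> {x..<y})
           \<and> (\<forall>x'. z = Some x' \<longrightarrow> 0 < x \<and> (\<exists>j<Suc t. cell j = x - 1 \<and> c j = x'))"
      proof cases
        case 1
        have "cell t \<notin> {x..<y}" using old[OF 1] p by blast
        then have "\<forall>j<Suc t. cell j \<notin> {x..<y}"
          using D(4)[OF 1(1)] less_Suc_eq by metis
        moreover have "\<forall>x'. z = Some x' \<longrightarrow> 0 < x \<and> (\<exists>j<Suc t. cell j = x - 1 \<and> c j = x')"
          using D(5)[of x y] 1(1) less_SucI by metis
        ultimately show ?thesis using D(2,3)[OF 1(1)] by blast
      next
        case 2
        then have "\<forall>j<Suc t. cell j \<notin> {x..<y}"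
          using D(4)[OF g(1)] g less_Suc_eq by force
        moreover have "\<forall>x'. z = Some x' \<longrightarrow> 0 < x \<and> (\<exists>j<Suc t. cell j = x - 1 \<and> c j = x')"
          using D(5)[of a b] g(1) less_SucI unfolding 2(2,4) by metis
        ultimately show ?thesis using 2 g D(3)[OF g(1)] by simp
      next
        case 3
        then have "\<forall>j<Suc t. cell j \<notin> {x..<y}"
          using D(4)[OF g(1)] g less_Suc_eq by force
        moreover have "\<forall>x'. z = Some x' \<longrightarrow> 0 < x \<and> (\<exists>j<Suc t. cell j = x - 1 \<and> c j = x')"
          unfolding 3(2,4) by auto
        ultimately show ?thesis using 3 g D(3)[OF g(1)] by simp
      qed
    qed
    show "\<forall>g\<in>gaps (Suc t). \<forall>h\<in>gaps (Suc t). g \<noteq> h \<longrightarrow>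
            {fst g..<fst (snd g)} \<inter> {fst h..<fst (snd h)} = {}"
    proof (intro ballI impI)
      fix g' h' assume gh: "g' \<in> gaps (Suc t)" "h' \<in> gaps (Suc t)" "g' \<noteq> h'"
      obtain x y z x' y' z' where eq: "g' = (x, y, z)" "h' = (x', y', z')"
        by (metis prod_cases3)
      have sub: "{x..<y} \<subseteq> {a..<b}" if "(x, y, z) \<in> gaps (Suc t)" "(x, y, z) \<notin> gaps t" for x y z
        using that g unfolding mem by auto
      have aux: "{x..<y} \<inter> {x'..<y'} = {}"
        if "(x, y, z) \<in> gaps (Suc t)" "(x', y', z') \<in> gaps (Suc t)"
          "(x, y, z) \<in> gaps t" "(x, y, z) \<noteq> (a, b, w)" "(x, y, z) \<noteq> (x', y', z')" for x y z x' y' z'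
      proof (cases "(x', y', z') \<in> gaps t")
        case True
        then show ?thesis using D(7)[OF that(3) True that(5)] by simp
      next
        case False
        then show ?thesis using sub[OF that(2) False] old[OF that(3,4)] by blast
      qed
      have "{x..<y} \<inter> {x'..<y'} = {}"
      proof (cases "((x, y, z) \<in> gaps t \<and> (x, y, z) \<noteq> (a, b, w))
          \<or> ((x', y', z') \<in> gaps t \<and> (x', y', z') \<noteq> (a, b, w))")
        case True
        then show ?thesis
          using gh aux[of x y z x' y' z'] aux[of x' y' z' x y z] unfolding eq by blast
      next
        case False
        then have "(a < cell t \<and> x = a \<and> y = cell t \<and> z = w)
            \<or> (Suc (cell t) < b \<and> x = Suc (cell t) \<and> y = b \<and> z = Some (c t))"
          "(a < cell t \<and> x' = a \<and> y' = cell t \<and> z' = w)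
            \<or> (Suc (cell t) < b \<and> x' = Suc (cell t) \<and> y' = b \<and> z' = Some (c t))"
          using gh(1,2) unfolding eq mem by blast+
        then show ?thesis
          using gh(3) unfolding eq by fastforce
      qed
      then show "{fst g'..<fst (snd g')} \<inter> {fst h'..<fst (snd h')} = {}"
        by (simp add: eq)
    qed
    \<comment> \<open>Over the reals the update by subtraction is exact; \<open>t < n\<close> leads
      back to \<open>nat\<close>.\<close>
    have "real (\<Sum>g\<in>gaps (Suc t). gap_length g) = real (n - t) - 1"
      unfolding of_nat_sum
      unfolding sum_gaps_Suc[OF wf ch g] D(6)[symmetric] of_nat_sum
      using g by (auto simp: gap_length_def of_nat_diff)
    then show "(\<Sum>g\<in>gaps (Suc t). gap_length g) = n - Suc t"
      using t by linarith
  qed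
qed

lemma well_formed: "t \<le> n \<Longrightarrow> 0 < n \<Longrightarrow> well_formed t"
proof (induction t)
  case 0
  then show ?case by (auto simp: well_formed_def gap_length_def)
next
  case (Suc t)
  then show ?case using well_formed_Suc[of t] by simp
qed

lemma cell_less:
  assumes "t < n" shows "cell t < n"
proof -
  have wf: "well_formed t" using assms well_formed by simp
  then show ?thesis using choice[OF wf assms] well_formedD(3)[OF wf] by (metis order_less_le_trans)
qed

lemma cell_neq:
  assumes "j < t" "t < n" shows "cell t \<noteq> cell j"
proof -
  have wf: "well_formed t" using assms well_formed by simp
  then obtain a b w where "(a, b, w) \<in> gaps t" "a \<le> cell t" "cell t < b"
    using choice[OF wf assms(2)] by metis
  then show ?thesis using well_formedD(4)[OF wf _ assms(1), of a b w] by auto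
qed

lemma cell_bij: "bij_betw cell {..<n} {..<n}"
proof -
  have "inj_on cell {..<n}"
  proof (rule linorder_inj_onI)
    fix x y assume "x < y" "x \<in> {..<n}" "y \<in> {..<n}"
    then show "cell x \<noteq> cell y" using cell_neq[of x y] by simp
  qed auto
  moreover have "cell ` {..<n} \<subseteq> {..<n}" using cell_less by auto
  ultimately show ?thesis
    by (simp add: bij_betw_def endo_inj_surj)
qed

end

section \<open>Amortized cost\<close>

locale gap_run_cost = gap_run n c for n :: nat and c :: "nat \<Rightarrow> real \<times> 'k" +
  fixes dis :: "'a \<Rightarrow> 'a \<Rightarrow> real" and A :: "nat \<Rightarrow> 'a" and N e :: real
  assumes n_pos: "0 < n" and N: "1 \<le> N" and e: "0 \<le> e"
    and scale_nonneg: "\<And>t. t < n \<Longrightarrow> 0 \<le> fst (c t)"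
    and scale_step: "\<And>t. Suc t < n \<Longrightarrow>
        fst (c (Suc t)) = fst (c t) \<or> fst (c t) < fst (c (Suc t)) \<and> 2 * fst (c t) \<le> fst (c (Suc t))"
    and dis_sym: "\<And>x y. dis x y = dis y x"
    and dis_nonneg: "\<And>x y. 0 \<le> dis x y"
    and dis_le: "\<And>i j. i < j \<Longrightarrow> j < n \<Longrightarrow> dis (A (cell i)) (A (cell j)) \<le> 2 * fst (c j)"
    and dis_same: "\<And>i j. i < j \<Longrightarrow> j < n \<Longrightarrow> c i = c j \<Longrightarrow> dis (A (cell i)) (A (cell j)) \<le> e * fst (c j)"
    and card_tags: "\<And>\<tau>. real (card {c j | j. j < n \<and> fst (c j) = \<tau>}) \<le> N"
begin

section \<open>Live gaps, credit and partial cost under one placement\<close>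

definition last_scale :: "nat \<Rightarrow> real" where
  "last_scale t = (if t = 0 then 0 else fst (c (t - 1)))"

definition live_count :: "real \<Rightarrow> nat \<Rightarrow> real" where
  "live_count \<tau> t = (\<Sum>g\<in>gaps t. of_bool (live \<tau> g))"

text \<open>
  When a gap is split, it has length at least \<open>m / N\<close> with \<open>m\<close> the number of empty cells, so both halves
  carry almost no credit.  A gap that is used up has accumulated credit \<open>1\<close>, which pays for the expensive
  adjacency at its right end and for the next start of its owner.
\<close>

definition credit :: "nat \<Rightarrow> nat \<Rightarrow> real" where
  "credit m l = max 0 (1 - 2 * N * real l / real m)"

definition total_credit :: "nat \<Rightarrow> real" where
  "total_credit t = (\<Sum>g\<in>gaps t. credit (n - t) (gap_length g))"

text \<open>The summand bounds the credit gained by placing item \<open>j\<close>. The total is a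
  multiple of a harmonic number, the source of the logarithm.\<close>

definition income :: "nat \<Rightarrow> real" where
  "income t = (\<Sum>j<t. 4 * N / real (n - j))"

definition joined :: "nat \<Rightarrow> nat set" where
  "joined t = {i. i \<in> cell ` {..<t} \<and> Suc i \<in> cell ` {..<t}}"

definition partial_cost :: "nat \<Rightarrow> real" where
  "partial_cost t = (\<Sum>i\<in>joined t. dis (A i) (A (Suc i)))"

lemma scale_mono:
  assumes "i \<le> j" "j < n" shows "fst (c i) \<le> fst (c j)"
  using assms
proof (induction j rule: dec_induct)
  case (step j)
  then show ?case using scale_step[of j] scale_nonneg[of j] by fastforce
qed simp

lemma scale_less_last: "j < t \<Longrightarrow> t \<le> n \<Longrightarrow> fst (c j) \<le> last_scale t"
  using scale_mono[of j "t - 1"] by (auto simp: last_scale_def)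

lemma credit_nonneg: "0 \<le> credit m l"
  by (simp add: credit_def)

text \<open>Keeping \<open>n - t\<close> in place of \<open>n - Suc t\<close> only overestimates:
  with fewer empty cells a gap of fixed length is relatively longer and has less credit.\<close>

lemma total_credit_Suc:
  assumes t: "t < n" and wf: "well_formed t"
    and ch: "choose_cell (c t) (gaps t) = ((a, b, w), p)" and g: "(a, b, w) \<in> gaps t" "a \<le> p" "p < b"
  shows "total_credit (Suc t) \<le> total_credit t - credit (n - t) (b - a)
    + (if a < p then credit (n - t) (p - a) else 0)
    + (if Suc p < b then credit (n - t) (b - Suc p) else 0)"
proof -
  have wf': "well_formed (Suc t)" using well_formed_Suc[OF wf t] .
  have "total_credit (Suc t) \<le> (\<Sum>g\<in>gaps (Suc t). credit (n - t) (gap_length g))"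
    unfolding total_credit_def
  proof (rule sum_mono)
    fix g assume gin: "g \<in> gaps (Suc t)"
    obtain x y z where xyz: "g = (x, y, z)" by (metis prod_cases3)
    \<comment> \<open>A surviving gap shows that some cell is still empty, so
      \<open>n - Suc t\<close> is a legitimate divisor.\<close>
    have "gap_length g \<le> n - Suc t"
      using member_le_sum[OF gin _ well_formedD(1)[OF wf'], of gap_length] well_formedD(6)[OF wf'] by simp
    moreover have "1 \<le> gap_length g"
      using well_formedD(2)[OF wf', of x y z] gin by (auto simp: xyz gap_length_def)
    ultimately have "0 < n - Suc t" by simp
    then have "2 * N * real (gap_length g) / real (n - t) \<le> 2 * N * real (gap_length g) / real (n - Suc t)"
      using N by (intro divide_left_mono) auto
    then show "credit (n - Suc t) (gap_length g) \<le> credit (n - t) (gap_length g)"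
      unfolding credit_def by (intro max.mono) auto
  qed
  also have "\<dots> = total_credit t - credit (n - t) (b - a)
    + (if a < p then credit (n - t) (p - a) else 0)
    + (if Suc p < b then credit (n - t) (b - Suc p) else 0)"
    unfolding sum_gaps_Suc[OF wf ch g] total_credit_def by (simp add: gap_length_def)
  finally show ?thesis .
qed

lemma live_count_Suc:
  assumes wf: "well_formed t"
    and ch: "choose_cell (c t) (gaps t) = ((a, b, w), p)" and g: "(a, b, w) \<in> gaps t" "a \<le> p" "p < b"
  shows "live_count (fst (c t)) (Suc t) = live_count (fst (c t)) t - of_bool (live (fst (c t)) (a, b, w))
    + (if a < p then of_bool (live (fst (c t)) (a, b, w)) else 0) + (if Suc p < b then 1 else 0)"
proof -
  have "live (fst (c t)) (x, y, Some (c t))" for x y :: nat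
    by (simp add: live_def prod_eq_iff)
  moreover have "live \<tau> (x, y, w) = live \<tau> (a, b, w)" for \<tau> x y
    by (simp add: live_def)
  from this[of _ a p] calculation show ?thesis
    unfolding live_count_def sum_gaps_Suc[OF wf ch g] by simp
qed

text \<open>Only the two adjacencies at the new cell can become complete. The test
  \<open>0 < cell t\<close> guards against \<open>0 - 1 = 0\<close>.\<close>

lemma partial_cost_Suc:
  "partial_cost (Suc t) \<le> partial_cost t
     + (if 0 < cell t \<and> cell t - 1 \<in> cell ` {..<t} then dis (A (cell t - 1)) (A (cell t)) else 0)
     + (if Suc (cell t) \<in> cell ` {..<t} then dis (A (cell t)) (A (Suc (cell t))) else 0)"
proof -
  let ?p = "cell t" and ?O = "cell ` {..<t}"
  let ?L = "if 0 < ?p \<and> ?p - 1 \<in> ?O then {?p - 1} else {}" and ?R = "if Suc ?p \<in> ?O then {?p} else {}"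
  let ?f = "\<lambda>i. dis (A i) (A (Suc i))"
  have O: "cell ` {..<Suc t} = insert ?p ?O" by (simp add: lessThan_Suc)
  have fin: "finite (joined t)"
    by (rule finite_subset[of _ "cell ` {..<t}"]) (auto simp: joined_def)
  have un: "sum ?f (U \<union> V) \<le> sum ?f U + sum ?f V" if "finite U" "finite V" for U V
    using sum_Un[OF that, of ?f] sum_nonneg[of "U \<inter> V" ?f] dis_nonneg by simp
  have "joined (Suc t) \<subseteq> (joined t \<union> ?L) \<union> ?R"
  proof
    fix i assume "i \<in> joined (Suc t)"
    then have i: "i = ?p \<or> i \<in> ?O" "Suc i = ?p \<or> Suc i \<in> ?O"
      unfolding joined_def O by auto
    show "i \<in> (joined t \<union> ?L) \<union> ?R"
    proof (cases "Suc i = ?p")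
      case True
      then have "i = ?p - 1" "0 < ?p" "i \<noteq> ?p" by linarith+
      then show ?thesis using i(1) by auto
    next
      case False
      then show ?thesis using i by (auto simp: joined_def)
    qed
  qed
  then have "partial_cost (Suc t) \<le> sum ?f ((joined t \<union> ?L) \<union> ?R)"
    unfolding partial_cost_def using fin dis_nonneg by (intro sum_mono2) auto
  also have "\<dots> \<le> sum ?f (joined t \<union> ?L) + sum ?f ?R"
    using fin by (intro un) auto
  also have "\<dots> \<le> (sum ?f (joined t) + sum ?f ?L) + sum ?f ?R"
    using fin by (intro add_right_mono un) auto
  finally show ?thesis
    by (auto simp: partial_cost_def split: if_splits)
qed

section \<open>Live gaps of one scale have different owners\<close>

definition owners_distinct :: "real \<Rightarrow> nat \<Rightarrow> bool" where
  "owners_distinct \<tau> t \<longleftrightarrow> inj_on (\<lambda>g. snd (snd g)) {g \<in> gaps t. live \<tau> g}"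

text \<open>The owner of a gap is the tag of an item already placed, and scales never
  decrease.\<close>

lemma not_live_later:
  assumes "well_formed t" "t \<le> n" "last_scale t < \<tau>" "g \<in> gaps t"
  shows "\<not> live \<tau> g"
proof
  assume "live \<tau> g"
  then obtain a b k where g: "g = (a, b, Some (\<tau>, k))"
    unfolding live_def by (metis prod.collapse)
  then obtain j where "j < t" "c j = (\<tau>, k)"
    using well_formedD(5)[OF assms(1), of a b "(\<tau>, k)"] assms(4) by blast
  then show False using scale_less_last[of j t] assms(2,3) by simp
qed

lemma live_owners:
  assumes wf: "well_formed t" and t: "t \<le> n"
  shows "(\<lambda>g. snd (snd g)) ` {g \<in> gaps t. live \<tau> g} \<subseteq> Some ` {c j | j. j < t \<and> fst (c j) = \<tau>}"
proof (clarify)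
  fix a b w assume g: "(a, b, w) \<in> gaps t" "live \<tau> (a, b, w)"
  then obtain k where w: "w = Some (\<tau>, k)" by (auto simp: live_def)
  then obtain j where "j < t" "c j = (\<tau>, k)"
    using well_formedD(5)[OF wf, of a b "(\<tau>, k)"] g by blast
  then show "snd (snd (a, b, w)) \<in> Some ` {c j | j. j < t \<and> fst (c j) = \<tau>}"
    by (force simp: w)
qed

lemma live_count_eq_card: "well_formed t \<Longrightarrow> live_count \<tau> t = real (card {g \<in> gaps t. live \<tau> g})"
  using well_formedD(1)[of t] by (simp add: live_count_def sum.If_cases of_bool_def Int_def)

text \<open>Different owners are different tags of the same scale, and \<open>N\<close> bounds the
  number of those.\<close>

lemma live_count_le:
  assumes wf: "well_formed t" and t: "t \<le> n" and inj: "owners_distinct \<tau> t"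
  shows "live_count \<tau> t \<le> N"
proof -
  have "card {g \<in> gaps t. live \<tau> g} \<le> card (Some ` {c j | j. j < n \<and> fst (c j) = \<tau>})"
    using live_owners[OF wf t, of \<tau>] inj t unfolding owners_distinct_def
    by (intro card_inj_on_le[where f = "\<lambda>g. snd (snd g)"]) (auto 4 4)
  also have "\<dots> = card {c j | j. j < n \<and> fst (c j) = \<tau>}"
    by (simp add: card_image)
  finally show ?thesis using card_tags[of \<tau>] live_count_eq_card[OF wf, of \<tau>] by linarith
qed

text \<open>For the third rule of \<open>choose_cell\<close>, which is used only when every gap is
  live: few gaps force the longest one to be long.\<close>

lemma card_gaps_le:
  assumes wf: "well_formed t" and t: "t < n" and inj: "owners_distinct (fst (c t)) t"
    and live: "\<And>g. g \<in> gaps t \<Longrightarrow> live (fst (c t)) g"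
  shows "real (card (gaps t)) \<le> N"
proof -
  have "live_count (fst (c t)) t \<le> N"
    using live_count_le[OF wf _ inj] t by simp
  moreover have "{g \<in> gaps t. live (fst (c t)) g} = gaps t" using live by blast
  ultimately show ?thesis using live_count_eq_card[OF wf, of "fst (c t)"] by simp
qed

text \<open>A gap owned by \<open>c t\<close> arises either in place of the one this tag already
  had, or when the tag had none. A left part inherits the owner of the gap it replaces.\<close>

lemma owners_distinct_Suc:
  assumes wf: "well_formed t" and t: "t < n" and inj: "owners_distinct (fst (c t)) t"
  shows "owners_distinct (fst (c t)) (Suc t)"
proof -
  have ne: "gaps t \<noteq> {}"
    using well_formedD(6)[OF wf] t by auto
  obtain a b w p where ch: "choose_cell (c t) (gaps t) = ((a, b, w), p)" and g: "(a, b, w) \<in> gaps t"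
    and own: "(w = Some (c t) \<and> p = a) \<or> (\<forall>g\<in>gaps t. snd (snd g) \<noteq> Some (c t))"
    by (rule choose_cell_cases[OF well_formedD(1)[OF wf] ne, of "c t"]) blast+
  show ?thesis
    unfolding owners_distinct_def
  proof (rule inj_onI)
    fix g1 g2
    assume g1: "g1 \<in> {g \<in> gaps (Suc t). live (fst (c t)) g}"
      and g2: "g2 \<in> {g \<in> gaps (Suc t). live (fst (c t)) g}" and eq: "snd (snd g1) = snd (snd g2)"
    have inj': "x = y" if "x \<in> gaps t" "y \<in> gaps t" "live (fst (c t)) x"
      "snd (snd x) = snd (snd y)" for x y
    proof -
      have "live (fst (c t)) y" using that by (simp add: live_def)
      then show ?thesis using inj_onD[OF inj[unfolded owners_distinct_def] that(4)] that by blast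
    qed
    have mem: "h = (Suc p, b, Some (c t)) \<or> h = (a, p, w) \<and> a < p \<or> h \<in> gaps t \<and> h \<noteq> (a, b, w)"
      if "h \<in> gaps (Suc t)" for h
      using that unfolding gaps_Suc[OF ch] by (auto split: if_splits)
    \<comment> \<open>Under the first rule the only gap of \<open>c t\<close> has been removed and
      \<open>p = a\<close> leaves no left part; under the other rules \<open>c t\<close> owned
      nothing.\<close>
    have no: "snd (snd h) \<noteq> Some (c t)" if "h = (a, p, w) \<and> a < p \<or> h \<in> gaps t \<and> h \<noteq> (a, b, w)"
      "live (fst (c t)) h" for h
      using own g that inj'[of h "(a, b, w)"] by auto
    show "g1 = g2"
    proof (cases "g1 = (Suc p, b, Some (c t)) \<or> g2 = (Suc p, b, Some (c t))")
      case True
      then show ?thesis using mem[of g1] mem[of g2] no[of g1] no[of g2] g1 g2 eq by auto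
    next
      case False
      then have "(g1 = (a, p, w) \<or> g1 \<in> gaps t \<and> g1 \<noteq> (a, b, w))"
        "(g2 = (a, p, w) \<or> g2 \<in> gaps t \<and> g2 \<noteq> (a, b, w))"
        using mem[of g1] mem[of g2] g1 g2 by blast+
      moreover have "live (fst (c t)) g1" "live (fst (c t)) g2" using g1 g2 by blast+
      ultimately show ?thesis
        using inj'[of g1 g2] inj'[of g1 "(a, b, w)"] inj'[of g2 "(a, b, w)"] g eq
        by (metis snd_conv)
    qed
  qed
qed

text \<open>At a new scale no gap is live yet, so the property is vacuous.\<close>

lemma owners_distinct_next:
  assumes wf: "well_formed t" and t: "t < n" and inj: "owners_distinct (last_scale t) t"
  shows "owners_distinct (fst (c t)) t"
proof (cases "fst (c t) = last_scale t")
  case False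
  have "last_scale t < fst (c t)"
    using False scale_step[of "t - 1"] scale_nonneg[of t] t by (auto simp: last_scale_def)
  then have "{g \<in> gaps t. live (fst (c t)) g} = {}"
    using not_live_later[OF wf] t by auto
  then show ?thesis unfolding owners_distinct_def by (metis inj_on_empty)
qed (use inj in simp)

section \<open>Cost of a single placement\<close>

lemma neighbour_cost_le:
  assumes "x \<in> cell ` {..<t}" "t < n"
  shows "dis (A x) (A (cell t)) \<le> 2 * fst (c t)" "dis (A (cell t)) (A x) \<le> 2 * fst (c t)"
proof -
  show "dis (A x) (A (cell t)) \<le> 2 * fst (c t)" using assms dis_le[of _ t] by auto
  then show "dis (A (cell t)) (A x) \<le> 2 * fst (c t)" by (subst dis_sym)
qed

text \<open>Before truncation, credit is linear in the length with slope \<open>- 2 * N / m\<close>,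
  and truncation at 0 does not enlarge differences. Used when an item takes the left end of a
  gap.\<close>

lemma credit_pred_le:
  assumes "0 < m" shows "credit m l \<le> credit m (Suc l) + 2 * N / real m"
proof -
  have "2 * N * real (Suc l) / real m = 2 * N * real l / real m + 2 * N / real m"
    by (simp add: algebra_simps add_divide_distrib)
  moreover have "max 0 (1 - x) \<le> max 0 (1 - (x + y)) + y" if "0 \<le> y" for x y :: real
    using that by (simp add: max_def)
  ultimately show ?thesis using N by (simp add: credit_def)
qed

text \<open>Here \<open>l\<close> is the length of the split gap and \<open>k\<close> that of a
  half. The worst case \<open>2 k = l - 2\<close> is the right half for even
  \<open>l\<close>.\<close>

lemma credit_half_le:
  assumes "real m \<le> N * real l" "0 < m" "real l - 2 \<le> 2 * real k"
  shows "credit m k \<le> 2 * N / real m"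
proof -
  have "N * (real l - 2) \<le> N * (2 * real k)"
    using assms N by (intro mult_left_mono) auto
  then have "real m - 2 * N \<le> 2 * N * real k"
    using assms(1) by (simp add: algebra_simps)
  then have "(real m - 2 * N * real k) / real m \<le> 2 * N / real m"
    by (intro divide_right_mono) auto
  then have "1 - 2 * N * real k / real m \<le> 2 * N / real m"
    using assms(2) by (simp add: diff_divide_distrib)
  then show ?thesis using N by (simp add: credit_def)
qed

lemma income_Suc: "income (Suc t) = income t + 4 * N / real (n - t)"
  by (simp add: income_def)

text \<open>\<open>\<kappa>\<close> is the cost of the step in units of the scale. A new live gap
  stands for one start of cost 2. A gap that is used up releases about one unit of credit, worth 4:
  this covers two expensive adjacencies, or one of them and the loss of a live gap.\<close>

lemma step_cost_bounds:
  assumes t: "t < n" and wf: "well_formed t" and inj: "owners_distinct (fst (c t)) t"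
  shows "\<exists>\<kappa>. partial_cost (Suc t) \<le> partial_cost t + fst (c t) * \<kappa> \<and>
     \<kappa> \<le> e + 2 * (live_count (fst (c t)) (Suc t) - live_count (fst (c t)) t)
        + 4 * (4 * N / real (n - t) - (total_credit (Suc t) - total_credit t)) \<and>
     total_credit (Suc t) - total_credit t \<le> 4 * N / real (n - t)"
proof -
  define p where "p = cell t"
  define m where "m = n - t"
  define \<tau> where "\<tau> = fst (c t)"
  define q where "q = 4 * N / real m"
  define L where "L = (if 0 < p \<and> p - 1 \<in> cell ` {..<t} then dis (A (p - 1)) (A p) else 0)"
  define R where "R = (if Suc p \<in> cell ` {..<t} then dis (A p) (A (Suc p)) else 0)"
  have m: "0 < m" using t by (simp add: m_def)
  have q: "0 \<le> q" "2 * N / real m = q / 2" using N by (auto simp: q_def)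
  have \<tau>: "0 \<le> \<tau>" using scale_nonneg[OF t] by (simp add: \<tau>_def)
  have cost: "partial_cost (Suc t) \<le> partial_cost t + L + R"
    using partial_cost_Suc[of t] unfolding L_def R_def p_def .
  have L: "L \<le> 2 * \<tau>" and R: "R \<le> 2 * \<tau>"
    using neighbour_cost_le[OF _ t] \<tau> by (auto simp: L_def R_def p_def \<tau>_def)
  have ne: "gaps t \<noteq> {}" using well_formedD(6)[OF wf] t by auto
  have L0: "L = 0" if "(a, b, w) \<in> gaps t" "a < p" "p < b" for a b w
    using well_formedD(4)[OF wf that(1)] that(2,3) by (fastforce simp: L_def)
  have R0: "R = 0" if "(a, b, w) \<in> gaps t" "a \<le> p" "Suc p < b" for a b w
    using well_formedD(4)[OF wf that(1)] that(2,3) by (fastforce simp: R_def)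
  \<comment> \<open>Credit released when a gap of length 1 is filled.\<close>
  have credit1: "1 - q / 2 \<le> credit m 1"
    using q(2) by (simp add: credit_def)
  \<comment> \<open>Each case below supplies only three numbers: the cost \<open>\<kappa>\<close>,
    the change \<open>y\<close> of the live count, and a bound \<open>\<mu>\<close> on the change of
    the credit.\<close>
  have claim: "\<exists>\<kappa>. partial_cost (Suc t) \<le> partial_cost t + \<tau> * \<kappa> \<and>
     \<kappa> \<le> e + 2 * (live_count \<tau> (Suc t) - live_count \<tau> t) + 4 * (q - (total_credit (Suc t) - total_credit t)) \<and>
     total_credit (Suc t) - total_credit t \<le> q"
    if "L + R \<le> \<tau> * \<kappa>" "live_count \<tau> (Suc t) = live_count \<tau> t + y"
      "total_credit (Suc t) \<le> total_credit t + \<mu>" "\<kappa> \<le> e + 2 * y + 4 * (q - \<mu>)" "\<mu> \<le> q" for \<kappa> y \<mu>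
  proof (intro exI[of _ \<kappa>] conjI)
    show "partial_cost (Suc t) \<le> partial_cost t + \<tau> * \<kappa>" using that cost by linarith
    show "total_credit (Suc t) - total_credit t \<le> q" using that by linarith
    show "\<kappa> \<le> e + 2 * (live_count \<tau> (Suc t) - live_count \<tau> t)
        + 4 * (q - (total_credit (Suc t) - total_credit t))" using that by argo
  qed
  have "\<exists>\<kappa>. partial_cost (Suc t) \<le> partial_cost t + \<tau> * \<kappa> \<and>
     \<kappa> \<le> e + 2 * (live_count \<tau> (Suc t) - live_count \<tau> t) + 4 * (q - (total_credit (Suc t) - total_credit t)) \<and>
     total_credit (Suc t) - total_credit t \<le> q"
    using well_formedD(1)[OF wf] ne
  proof (cases rule: choose_cell_cases[where c = "c t"])
    case (own a b)
    have pa: "p = a" using own(1) by (simp add: p_def gap_cell_def)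
    have ab: "a < b" using well_formedD(2)[OF wf own(2)] .
    note lc = live_count_Suc[OF wf own order_refl ab, folded \<tau>_def]
    note tc = total_credit_Suc[OF t wf own order_refl ab, folded m_def]
    have lv: "live \<tau> (a, b, Some (c t))" by (simp add: live_def \<tau>_def prod_eq_iff)
    obtain j where "j < t" "cell j = a - 1" "c j = c t"
      using well_formedD(5)[OF wf own(2)] by blast
    then have "L \<le> e * \<tau>"
      using dis_same[of j t] t e \<tau> by (auto simp: L_def pa[symmetric] p_def \<tau>_def)
    show ?thesis
    proof (cases "Suc a < b")
      case True
      have "R = 0" using R0[OF own(2)] True pa by simp
      moreover have "credit m (b - Suc a) \<le> credit m (b - a) + q / 2"
        using credit_pred_le[OF m, of "b - Suc a"] True q(2) by (simp add: Suc_diff_Suc)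
      ultimately show ?thesis
        using lc lv tc True \<open>L \<le> e * \<tau>\<close> q by (intro claim[of e 0 "q / 2"]) (simp_all add: algebra_simps)
    next
      \<comment> \<open>The gap is used up. Its credit pays 2 for the right neighbour and 2 for the
        live gap that disappears.\<close>
      case False
      then have "b - a = 1" using ab by simp
      then show ?thesis
        using lc lv tc False \<open>L \<le> e * \<tau>\<close> R credit1 q
        by (intro claim[of "e + 2" "-1" "q / 2 - 1"]) (simp_all add: algebra_simps)
    qed
  next
    case (stale a b w)
    have pa: "p = a" using stale(1) by (simp add: p_def gap_cell_def)
    have ab: "a < b" using well_formedD(2)[OF wf stale(2)] .
    note lc = live_count_Suc[OF wf stale(1,2) order_refl ab, folded \<tau>_def]
    note tc = total_credit_Suc[OF t wf stale(1,2) order_refl ab, folded m_def]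
    have lv: "\<not> live \<tau> (a, b, w)" using stale(3) by (simp add: \<tau>_def)
    show ?thesis
    proof (cases "Suc a < b")
      \<comment> \<open>A stale gap is replaced by a live one, and this increase pays for the
        expensive left neighbour.\<close>
      case True
      have "R = 0" using R0[OF stale(2)] True pa by simp
      moreover have "credit m (b - Suc a) \<le> credit m (b - a) + q / 2"
        using credit_pred_le[OF m, of "b - Suc a"] True q(2) by (simp add: Suc_diff_Suc)
      ultimately show ?thesis
        using lc lv tc True L q e by (intro claim[of 2 1 "q / 2"]) (simp_all add: algebra_simps)
    next
      \<comment> \<open>Both neighbours may be expensive and no live gap is gained; the released
        credit pays 4.\<close>
      case False
      then have "b - a = 1" using ab by simp
      then show ?thesis
        using lc lv tc False L R credit1 q e by (intro claim[of 4 0 "q / 2 - 1"]) (simp_all add: algebra_simps)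
    qed
  next
    case (longest a b w)
    have ab: "a < b" using well_formedD(2)[OF wf longest(2)] .
    have p: "p = a + (b - a) div 2" using longest(1) by (simp add: p_def gap_cell_def)
    then have pb: "a \<le> p" "p < b" using ab by auto
    note ch = longest(1)[folded p]
    note lc = live_count_Suc[OF wf ch longest(2) pb, folded \<tau>_def]
    note tc = total_credit_Suc[OF t wf ch longest(2) pb, folded m_def]
    have lv: "live \<tau> (a, b, w)" using longest(3)[OF longest(2)] by (simp add: \<tau>_def)
    \<comment> \<open>The longest gap has at least average length, and there are at most
      \<open>N\<close> gaps.\<close>
    have "m \<le> card (gaps t) * (b - a)"
      using sum_bounded_above[of "gaps t" gap_length "b - a"] longest(5) well_formedD(6)[OF wf]
      by (simp add: m_def)
    then have "real m \<le> real (card (gaps t)) * real (b - a)"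
      by (metis of_nat_le_iff of_nat_mult)
    also have "\<dots> \<le> N * real (b - a)"
      using card_gaps_le[OF wf t inj longest(3)] by (intro mult_right_mono) auto
    finally have mN: "real m \<le> N * real (b - a)" .
    have "credit m (p - a) \<le> q / 2" "credit m (b - Suc p) \<le> q / 2"
      using credit_half_le[OF mN m] p ab q(2) by (auto simp: of_nat_diff)
    note cr = this credit_nonneg[of m "b - a"]
    consider "b - a = 1" | "b - a = 2" | "3 \<le> b - a" using ab by linarith
    then show ?thesis
    proof cases
      \<comment> \<open>Now \<open>m \<le> N\<close>, so the income of this step alone pays for both
        neighbours and for the lost live gap.\<close>
      case 1
      then have "4 \<le> q" using mN m by (simp add: q_def field_simps)
      moreover have "\<not> a < p" "\<not> Suc p < b" using 1 p by auto
      ultimately show ?thesis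
        using lc lv tc cr L R e \<tau> by (intro claim[of 4 "-1" 0]) (simp_all add: algebra_simps)
    next
      \<comment> \<open>The middle is the right one of the two cells, so only the right neighbour
        can be filled.\<close>
      case 2
      then have "2 \<le> q" using mN m by (simp add: q_def field_simps)
      moreover have "a < p" "\<not> Suc p < b" using 2 p by auto
      moreover have "L = 0" using L0[OF longest(2)] \<open>a < p\<close> pb by simp
      ultimately show ?thesis
        using lc lv tc cr R e \<tau> by (intro claim[of 2 0 "q / 2"]) (simp_all add: algebra_simps)
    next
      \<comment> \<open>No neighbour is filled and nothing is paid; the whole income becomes credit
        of the two halves.\<close>
      case 3
      then have "a < p" "Suc p < b" using p by auto
      moreover have "L = 0" using L0[OF longest(2)] \<open>a < p\<close> pb by simp
      moreover have "R = 0" using R0[OF longest(2)] \<open>Suc p < b\<close> pb by simp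
      ultimately show ?thesis
        using lc lv tc cr e \<tau> by (intro claim[of 0 1 q]) (simp_all add: algebra_simps)
    qed
  qed
  then show ?thesis by (simp add: \<tau>_def q_def m_def)
qed

text \<open>
  Starts within the current scale that are not yet paid for by a used-up gap correspond to live gaps,
  of which there are at most \<open>N\<close>.  A new scale is at least twice the old one, so \<open>2 * N + 2 * N\<close> at
  the old scale is at most \<open>2 * N\<close> at the new one, where no gap is live yet.
\<close>

lemma amortized_cost:
  assumes "t \<le> n"
  shows "owners_distinct (last_scale t) t \<and> total_credit t \<le> income t \<and>
    partial_cost t \<le> last_scale t * (real t * e + 2 * N + 2 * live_count (last_scale t) t
      + 4 * (income t - total_credit t))"
  using assms
proof (induction t)
  case 0
  \<comment> \<open>Since \<open>N \<ge> 1\<close>, the full array starts without credit.\<close>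
  have "credit n n = 0" using N n_pos by (simp add: credit_def)
  moreover have "{g \<in> gaps 0. live 0 g} = {}" by (auto simp: live_def)
  then have "owners_distinct 0 0" unfolding owners_distinct_def by (metis inj_on_empty)
  ultimately show ?case
    by (simp add: total_credit_def gap_length_def income_def partial_cost_def
        joined_def last_scale_def)
next
  case (Suc t)
  then have t: "t < n" and IH: "owners_distinct (last_scale t) t" "total_credit t \<le> income t"
    "partial_cost t \<le> last_scale t * (real t * e + 2 * N + 2 * live_count (last_scale t) t
      + 4 * (income t - total_credit t))"
    by auto
  have wf: "well_formed t" using well_formed[of t] t by simp
  define \<tau> where "\<tau> = fst (c t)"
  have \<tau>: "0 \<le> \<tau>" using scale_nonneg[OF t] by (simp add: \<tau>_def)
  have ls: "last_scale (Suc t) = \<tau>" by (simp add: last_scale_def \<tau>_def)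
  have inj: "owners_distinct \<tau> t" using owners_distinct_next[OF wf t IH(1)] by (simp add: \<tau>_def)
  have old: "partial_cost t \<le> \<tau> * (real t * e + 2 * N + 2 * live_count \<tau> t + 4 * (income t - total_credit t))"
  proof (cases "\<tau> = last_scale t")
    case True
    then show ?thesis using IH(3) by simp
  next
    case False
    let ?s = "last_scale t" and ?r = "real t * e + 4 * (income t - total_credit t)"
    have s: "0 \<le> ?s" "2 * ?s \<le> \<tau>"
      using False scale_step[of "t - 1"] scale_nonneg[of "t - 1"] \<tau> t
      by (auto simp: last_scale_def \<tau>_def)
    have r: "0 \<le> ?r" using IH(2) e by simp
    have "partial_cost t \<le> ?s * ?r + ?s * (2 * N + 2 * live_count ?s t)"
      using IH(3) by (simp add: algebra_simps)
    also have "\<dots> \<le> ?s * ?r + ?s * (4 * N)"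
      using live_count_le[OF wf _ IH(1)] t s by (intro add_left_mono mult_left_mono) auto
    also have "\<dots> = ?s * ?r + (2 * ?s) * (2 * N)"
      by simp
    also have "\<dots> \<le> \<tau> * ?r + \<tau> * (2 * N)"
      using s r N by (intro add_mono mult_right_mono) auto
    also have "\<dots> \<le> \<tau> * ?r + \<tau> * (2 * N) + \<tau> * (2 * live_count \<tau> t)"
      using \<tau> by (simp add: live_count_def sum_nonneg)
    finally show ?thesis by (simp add: algebra_simps)
  qed
  obtain \<kappa> where \<kappa>: "partial_cost (Suc t) \<le> partial_cost t + \<tau> * \<kappa>"
    "\<kappa> \<le> e + 2 * (live_count \<tau> (Suc t) - live_count \<tau> t)
        + 4 * (4 * N / real (n - t) - (total_credit (Suc t) - total_credit t))"
    "total_credit (Suc t) - total_credit t \<le> 4 * N / real (n - t)"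
    using step_cost_bounds[OF t wf] inj unfolding \<tau>_def by blast
  have "partial_cost (Suc t) \<le> \<tau> * (real t * e + 2 * N + 2 * live_count \<tau> t + 4 * (income t - total_credit t))
      + \<tau> * (e + 2 * (live_count \<tau> (Suc t) - live_count \<tau> t)
        + 4 * (4 * N / real (n - t) - (total_credit (Suc t) - total_credit t)))"
    using \<kappa>(1) old mult_left_mono[OF \<kappa>(2) \<tau>] by linarith
  also have "\<dots> = \<tau> * (real (Suc t) * e + 2 * N + 2 * live_count \<tau> (Suc t)
      + 4 * (income (Suc t) - total_credit (Suc t)))"
    unfolding distrib_left[symmetric] income_Suc of_nat_Suc by (simp add: algebra_simps)
  finally show ?case
    using owners_distinct_Suc[OF wf t] inj IH(2) \<kappa>(3) unfolding ls income_Suc \<tau>_def by simp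
qed

text \<open>The 20 is 2 for the term \<open>2 * N\<close>, 2 for the live gaps, and 16 for four
  times the income of at most \<open>4 * N * (1 + ln n)\<close>.\<close>

lemma total_cost_le:
  "(\<Sum>i<n - 1. dis (A i) (A (Suc i))) \<le> fst (c (n - 1)) * (real n * e + 20 * N * (1 + ln (real n)))"
proof -
  define \<tau> where "\<tau> = fst (c (n - 1))"
  have \<tau>: "0 \<le> \<tau>" using scale_nonneg[of "n - 1"] n_pos by (simp add: \<tau>_def)
  have ls: "last_scale n = \<tau>" using n_pos by (simp add: last_scale_def \<tau>_def)
  note amort = amortized_cost[of n, unfolded ls]
  have "cell ` {..<n} = {..<n}" using cell_bij by (simp add: bij_betw_def)
  then have "joined n = {..<n - 1}" unfolding joined_def by auto
  then have "(\<Sum>i<n - 1. dis (A i) (A (Suc i))) = partial_cost n" by (simp add: partial_cost_def)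
  also have "\<dots> \<le> \<tau> * (real n * e + 2 * N + 2 * live_count \<tau> n + 4 * (income n - total_credit n))"
    using amort by simp
  also have "\<dots> \<le> \<tau> * (real n * e + 20 * N * (1 + ln (real n)))"
  proof (rule mult_left_mono[OF _ \<tau>])
    have "income n = (\<Sum>j<n. 4 * N / real (Suc j))"
      unfolding income_def by (subst sum.nat_diff_reindex[symmetric]) (auto intro!: sum.cong)
    also have "\<dots> = 4 * N * harm n"
      by (simp add: harm_altdef sum_distrib_left divide_inverse)
    \<comment> \<open>\<open>harm n - ln n\<close> decreases from its value 1 at
      \<open>n = 1\<close>.\<close>
    also have "\<dots> \<le> 4 * N * (1 + ln (real n))"
      using N n_pos euler_mascheroni_sequence_decreasing[of 1 n]
      by (intro mult_left_mono) (auto simp: harm_altdef)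
    finally have "income n \<le> 4 * (N * (1 + ln (real n)))" by (simp add: mult.assoc)
    moreover have "live_count \<tau> n \<le> N"
      using live_count_le[OF well_formed] amort n_pos by simp
    moreover have "0 \<le> total_credit n" by (simp add: total_credit_def credit_nonneg sum_nonneg)
    moreover have "N \<le> N * (1 + ln (real n))"
      using N n_pos by simp
    ultimately show "real n * e + 2 * N + 2 * live_count \<tau> n + 4 * (income n - total_credit n)
        \<le> real n * e + 20 * N * (1 + ln (real n))"
      by argo
  qed
  finally show ?thesis by (simp add: \<tau>_def)
qed

end

section \<open>Walks and grids\<close>

text \<open>Holds for arbitrary sequences, as only the first \<open>d\<close> coordinates enter.
  Walks may therefore visit points outside the carrier.\<close>

lemma Rn_triangle:
  "mdist (Rn_metric d) x z \<le> mdist (Rn_metric d) x y + mdist (Rn_metric d) y z"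
  using L2_set_triangle_ineq[of "\<lambda>i. x i - y i" "\<lambda>i. y i - z i" "{..<d}"] by simp

lemma Rn_dist_le_walk:
  assumes "i < j"
  shows "mdist (Rn_metric d) (A i) (A j) \<le> (\<Sum>k = i..<j. mdist (Rn_metric d) (A k) (A (Suc k)))"
  using assms
proof (induction j)
  case (Suc j)
  show ?case
  proof (cases "i = j")
    case False
    then show ?thesis
      using Suc Rn_triangle[of d "A i" "A (Suc j)" "A j"] by simp
  qed simp
qed simp

lemma array_cost_nonneg: "0 \<le> array_cost m n A"
  by (simp add: array_cost_def sum_nonneg)

lemma sum_steps_le_array_cost:
  assumes "j < n"
  shows "(\<Sum>k = i..<j. mdist m (A k) (A (Suc k))) \<le> array_cost m n A"
  unfolding array_cost_def using assms by (intro sum_mono2) auto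

text \<open>Between consecutive indices in \<open>I\<close> the walk travels at least
  \<open>\<epsilon>\<close>; the induction adds the largest index.\<close>

lemma separated_le_walk:
  assumes "finite I" "I \<noteq> {}" and "0 \<le> \<epsilon>"
    and "\<And>i j. i \<in> I \<Longrightarrow> j \<in> I \<Longrightarrow> i \<noteq> j \<Longrightarrow> \<epsilon> \<le> mdist (Rn_metric d) (A i) (A j)"
  shows "\<epsilon> * (real (card I) - 1) \<le> (\<Sum>k = 0..<Max I. mdist (Rn_metric d) (A k) (A (Suc k)))"
  using assms
proof (induction I rule: finite_linorder_max_induct)
  case (insert b I)
  let ?D = "\<lambda>k. mdist (Rn_metric d) (A k) (A (Suc k))"
  show ?case
  proof (cases "I = {}")
    case True
    then show ?thesis by (simp add: sum_nonneg)
  next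
    case False
    have less: "Max I < b" using insert.hyps False by simp
    have "\<epsilon> * (real (card I) - 1) \<le> sum ?D {0..<Max I}"
      using insert False by blast
    moreover have "\<epsilon> \<le> sum ?D {Max I..<b}"
      using insert.prems(3)[of "Max I" b] less insert.hyps False Rn_dist_le_walk[OF less, of d A]
      by (simp del: mdist_Rn_metric)
    moreover have "sum ?D {0..<b} = sum ?D {0..<Max I} + sum ?D {Max I..<b}"
      using less by (simp add: sum.atLeastLessThan_concat)
    moreover have "Max (insert b I) = b" using less insert.hyps False by simp
    moreover have "card (insert b I) = Suc (card I)" using insert.hyps by auto
    ultimately show ?thesis by (simp add: algebra_simps)
  qed
qed simp

section \<open>Grid cells met by a walk\<close>

definition grid_cell :: "nat \<Rightarrow> real \<Rightarrow> (nat \<Rightarrow> real) \<Rightarrow> nat \<Rightarrow> int" where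
  "grid_cell d \<epsilon> x = (\<lambda>i\<in>{..<d}. \<lfloor>x i / \<epsilon>\<rfloor>)"

lemma abs_diff_le_Rn_dist: "i < d \<Longrightarrow> \<bar>x i - y i\<bar> \<le> mdist (Rn_metric d) x y"
  using member_le_L2_set[of "{..<d}" i "\<lambda>i. \<bar>x i - y i\<bar>"] by (simp add: L2_set_def)

lemma dist_in_grid_cell:
  assumes "0 < \<epsilon>" "grid_cell d \<epsilon> x = grid_cell d \<epsilon> y"
  shows "mdist (Rn_metric d) x y \<le> sqrt (real d) * \<epsilon>"
proof -
  have "(x i - y i)\<^sup>2 \<le> \<epsilon>\<^sup>2" if "i < d" for i
  proof -
    have "\<lfloor>x i / \<epsilon>\<rfloor> = \<lfloor>y i / \<epsilon>\<rfloor>"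
      using fun_cong[OF assms(2), of i] that by (simp add: grid_cell_def)
    then have "\<bar>x i / \<epsilon> - y i / \<epsilon>\<bar> \<le> 1" by linarith
    then have "\<bar>x i - y i\<bar> \<le> \<epsilon>"
      using assms(1) by (simp add: diff_divide_distrib[symmetric] abs_divide)
    then show ?thesis using abs_le_square_iff[of "x i - y i" \<epsilon>] assms(1) by simp
  qed
  then have "(\<Sum>i<d. (x i - y i)\<^sup>2) \<le> real d * \<epsilon>\<^sup>2"
    using sum_bounded_above[of "{..<d}" "\<lambda>i. (x i - y i)\<^sup>2" "\<epsilon>\<^sup>2"] by simp
  then have "sqrt (\<Sum>i<d. (x i - y i)\<^sup>2) \<le> sqrt (real d * \<epsilon>\<^sup>2)"
    by (rule real_sqrt_le_mono)
  then show ?thesis using assms(1) by (simp add: L2_set_def real_sqrt_mult)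
qed

text \<open>Different integers of equal parity differ by at least 2, so a whole cell width separates
  the points in that coordinate.\<close>

lemma dist_same_parity:
  assumes "0 < \<epsilon>" and ne: "grid_cell d \<epsilon> x \<noteq> grid_cell d \<epsilon> y"
    and par: "\<And>i. i < d \<Longrightarrow> grid_cell d \<epsilon> x i mod 2 = grid_cell d \<epsilon> y i mod 2"
  shows "\<epsilon> \<le> mdist (Rn_metric d) x y"
proof -
  obtain i where i: "grid_cell d \<epsilon> x i \<noteq> grid_cell d \<epsilon> y i" using ne by blast
  then have id: "i < d" by (auto simp: grid_cell_def restrict_def split: if_splits)
  have "\<lfloor>x i / \<epsilon>\<rfloor> \<noteq> \<lfloor>y i / \<epsilon>\<rfloor>" "\<lfloor>x i / \<epsilon>\<rfloor> mod 2 = \<lfloor>y i / \<epsilon>\<rfloor> mod 2"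
    using i par[OF id] id by (auto simp: grid_cell_def)
  then have "2 \<le> \<bar>\<lfloor>x i / \<epsilon>\<rfloor> - \<lfloor>y i / \<epsilon>\<rfloor>\<bar>" by presburger
  then have "1 \<le> \<bar>x i / \<epsilon> - y i / \<epsilon>\<bar>" by linarith
  then have "\<epsilon> \<le> \<bar>x i - y i\<bar>"
    using assms(1) by (simp add: diff_divide_distrib[symmetric] abs_divide)
  also have "\<dots> \<le> mdist (Rn_metric d) x y" by (rule abs_diff_le_Rn_dist[OF id])
  finally show ?thesis .
qed

text \<open>The factor \<open>2 ^ d\<close> is the number of parity classes of grid cells.\<close>

lemma card_grid_cells_le:
  assumes "0 < \<epsilon>" and S: "S \<subseteq> A ` {..<n}"
  shows "real (card (grid_cell d \<epsilon> ` S)) \<le> 2 ^ d * (array_cost (Rn_metric d) n A / \<epsilon> + 1)"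
proof -
  let ?C = "grid_cell d \<epsilon> ` S" and ?W = "array_cost (Rn_metric d) n A"
  define par where "par k = (\<lambda>i\<in>{..<d}. k i mod (2::int))" for k
  define Q where "Q = {..<d} \<rightarrow>\<^sub>E {0, 1::int}"
  have finC: "finite ?C" using finite_subset[OF S] by simp
  have Q: "finite Q" "card Q = 2 ^ d"
    by (auto simp: Q_def card_PiE numeral_2_eq_2 intro: finite_PiE)
  have class_le: "real (card {k \<in> ?C. par k = q}) \<le> ?W / \<epsilon> + 1" for q
  proof (cases "{k \<in> ?C. par k = q} = {}")
    case True
    then show ?thesis using assms(1) by (simp only: True) (simp add: array_cost_nonneg add_nonneg_nonneg)
  next
    case False
    let ?K = "{k \<in> ?C. par k = q}"
    have "\<exists>i. i < n \<and> grid_cell d \<epsilon> (A i) = k" if "k \<in> ?C" for k using that S by blast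
    \<comment> \<open>One visiting time for each grid cell; within a parity class the points visited
      are pairwise at least \<open>\<epsilon>\<close> apart.\<close>
    then obtain idx where idx: "\<And>k. k \<in> ?C \<Longrightarrow> idx k < n \<and> grid_cell d \<epsilon> (A (idx k)) = k" by metis
    have inj: "inj_on idx ?K" by (rule inj_onI) (use idx in \<open>metis (mono_tags, lifting) mem_Collect_eq\<close>)
    have "\<epsilon> * (real (card (idx ` ?K)) - 1)
        \<le> (\<Sum>k = 0..<Max (idx ` ?K). mdist (Rn_metric d) (A k) (A (Suc k)))"
    proof (rule separated_le_walk)
      fix i j assume ij: "i \<in> idx ` ?K" "j \<in> idx ` ?K" "i \<noteq> j"
      obtain k where k: "i = idx k" "k \<in> ?K" using ij(1) by (rule imageE)
      obtain l where l: "j = idx l" "l \<in> ?K" using ij(2) by (rule imageE)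
      have kl: "i = idx k" "j = idx l" "k \<in> ?C" "l \<in> ?C" "par k = par l" "k \<noteq> l"
        using k(1) l(1) ij(3) CollectD[OF k(2)] CollectD[OF l(2)] by metis+
      have "k i mod 2 = l i mod 2" if "i < d" for i
        using fun_cong[OF kl(5), of i] that by (simp add: par_def)
      then show "\<epsilon> \<le> mdist (Rn_metric d) (A i) (A j)"
        using idx[OF kl(3)] idx[OF kl(4)] kl(1,2,6) by (intro dist_same_parity[OF assms(1)]) auto
    qed (use finC False assms(1) in auto)
    also have "\<dots> \<le> ?W"
    proof (rule sum_steps_le_array_cost)
      have "Max (idx ` ?K) \<in> idx ` ?K" using finC False by (intro Max_in) auto
      then show "Max (idx ` ?K) < n" using idx by auto
    qed
    finally have "\<epsilon> * (real (card ?K) - 1) \<le> ?W" by (simp add: card_image[OF inj])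
    then show ?thesis using assms(1) by (simp add: field_simps)
  qed
  have "par k \<in> Q" for k
    by (auto simp: Q_def par_def)
  then have "?C = (\<Union>q\<in>Q. {k \<in> ?C. par k = q})"
    by blast
  then have "card ?C \<le> (\<Sum>q\<in>Q. card {k \<in> ?C. par k = q})"
    using card_UN_le[OF Q(1), of "\<lambda>q. {k \<in> ?C. par k = q}"] by simp
  then have "real (card ?C) \<le> (\<Sum>q\<in>Q. real (card {k \<in> ?C. par k = q}))"
    unfolding of_nat_sum[symmetric] of_nat_le_iff .
  also have "\<dots> \<le> real (card Q) * (?W / \<epsilon> + 1)"
    by (rule sum_bounded_above) (rule class_le)
  finally show ?thesis by (simp add: Q)
qed

text \<open>
  Unlike the optimal tour, the infimum over all walks that visit \<open>S\<close> is monotone in \<open>S\<close> without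
  any shortcutting argument.
\<close>

definition walk_inf :: "'a metric \<Rightarrow> 'a set \<Rightarrow> real" where
  "walk_inf m S = Inf {array_cost m n A | n A. S \<subseteq> A ` {..<n}}"

lemma walk_inf_le: "S \<subseteq> A ` {..<n} \<Longrightarrow> walk_inf m S \<le> array_cost m n A"
  unfolding walk_inf_def by (rule cInf_lower) (auto intro!: bdd_belowI[of _ 0] array_cost_nonneg)

lemma walk_inf_ge:
  assumes "finite S" and "\<And>n A. S \<subseteq> A ` {..<n} \<Longrightarrow> w \<le> array_cost m n A"
  shows "w \<le> walk_inf m S"
  unfolding walk_inf_def
proof (rule cInf_greatest)
  obtain xs where "set xs = S" using finite_list[OF assms(1)] by blast
  then have "S \<subseteq> (\<lambda>i. xs ! i) ` {..<length xs}" by (auto simp: set_conv_nth)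
  then show "{array_cost m n A | n A. S \<subseteq> A ` {..<n}} \<noteq> {}" by blast
qed (use assms(2) in blast)

lemma walk_inf_nonneg: "finite S \<Longrightarrow> 0 \<le> walk_inf m S"
  by (rule walk_inf_ge) (auto intro: array_cost_nonneg)

lemma walk_inf_mono: "finite T \<Longrightarrow> S \<subseteq> T \<Longrightarrow> walk_inf m S \<le> walk_inf m T"
  by (rule walk_inf_ge) (auto intro: walk_inf_le)

lemma dist_le_walk_inf:
  assumes "finite S" "x \<in> S" "y \<in> S"
  shows "mdist (Rn_metric d) x y \<le> walk_inf (Rn_metric d) S"
proof (rule walk_inf_ge[OF assms(1)])
  fix n :: nat and A assume "S \<subseteq> A ` {..<n}"
  then obtain i j where ij: "i < n" "j < n" "x = A i" "y = A j" using assms by blast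
  have *: "mdist (Rn_metric d) (A i) (A j) \<le> array_cost (Rn_metric d) n A" if "i < j" "j < n" for i j
    using Rn_dist_le_walk[OF that(1)] sum_steps_le_array_cost[OF that(2)] by (rule order_trans)
  show "mdist (Rn_metric d) x y \<le> array_cost (Rn_metric d) n A"
  proof (cases i j rule: linorder_cases)
    case equal
    then have "x = y" using ij by simp
    then show ?thesis using array_cost_nonneg[of "Rn_metric d" n A] by (simp add: L2_set_def)
  qed (use * ij mdist_commute in metis)+
qed

lemma card_grid_cells_le_walk_inf:
  assumes "finite S" "0 < \<epsilon>"
  shows "real (card (grid_cell d \<epsilon> ` S)) \<le> 2 ^ d * (walk_inf (Rn_metric d) S / \<epsilon> + 1)"
proof -
  \<comment> \<open>Solved for the length of the walk, the bound passes to the infimum.\<close>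
  have "\<epsilon> * (real (card (grid_cell d \<epsilon> ` S)) / 2 ^ d - 1) \<le> walk_inf (Rn_metric d) S"
  proof (rule walk_inf_ge[OF assms(1)])
    fix n :: nat and A assume "S \<subseteq> A ` {..<n}"
    from card_grid_cells_le[OF assms(2) this, of d]
    show "\<epsilon> * (real (card (grid_cell d \<epsilon> ` S)) / 2 ^ d - 1) \<le> array_cost (Rn_metric d) n A"
      using assms(2) by (simp add: field_simps)
  qed
  then show ?thesis using assms(2) by (simp add: field_simps)
qed

text \<open>Every filled array is itself a walk through all items.\<close>

lemma walk_inf_le_tsp_opt: "walk_inf m (set X) \<le> tsp_opt m X"
proof -
  let ?P = "{\<pi>. \<pi> permutes {..<length X}}"
  have "walk_inf m (set X) \<le> array_cost m (length X) (filled_array X \<pi>)" if "\<pi> \<in> ?P" for \<pi>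
  proof (rule walk_inf_le)
    show "set X \<subseteq> filled_array X \<pi> ` {..<length X}"
    proof
      fix x assume "x \<in> set X"
      then obtain j where j: "j < length X" "X ! j = x" by (auto simp: in_set_conv_nth)
      have "inj_on \<pi> {..<length X}" "\<pi> j < length X"
        using that j permutes_inj_on permutes_in_image[of \<pi> "{..<length X}" j] by auto
      then show "x \<in> filled_array X \<pi> ` {..<length X}"
        using j by (auto simp: filled_array_def intro!: image_eqI[of _ _ "\<pi> j"])
    qed
  qed
  moreover have "?P \<noteq> {}" using permutes_id[of "{..<length X}"] by blast
  ultimately show ?thesis
    unfolding tsp_opt_def by (subst Min_ge_iff) (auto simp: finite_permutations)
qed

section \<open>Rounding down to powers of two\<close>

definition dyadic_floor :: "real \<Rightarrow> real" where
  "dyadic_floor w = (if w \<le> 0 then 0 else 2 powr of_int \<lfloor>log 2 w\<rfloor>)"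

lemma dyadic_floor_nonneg: "0 \<le> dyadic_floor w"
  by (simp add: dyadic_floor_def)

lemma dyadic_floor_le: "0 \<le> w \<Longrightarrow> dyadic_floor w \<le> w"
  using powr_mono[of "of_int \<lfloor>log 2 w\<rfloor>" "log 2 w" 2] by (cases "w = 0") (auto simp: dyadic_floor_def)

lemma le_dyadic_floor: "w \<le> 2 * dyadic_floor w"
proof (cases "w \<le> 0")
  case False
  have "w = 2 powr (log 2 w)" using False by simp
  also have "\<dots> \<le> 2 powr (1 + of_int \<lfloor>log 2 w\<rfloor>)" by (intro powr_mono) linarith+
  also have "\<dots> = 2 * dyadic_floor w" using False by (simp add: dyadic_floor_def powr_add)
  finally show ?thesis .
qed (simp add: dyadic_floor_def)

lemma dyadic_floor_gap:
  assumes "v \<le> w"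
  shows "dyadic_floor w = dyadic_floor v \<or>
    dyadic_floor v < dyadic_floor w \<and> 2 * dyadic_floor v \<le> dyadic_floor w"
proof (cases "v \<le> 0")
  case True
  then show ?thesis by (simp add: dyadic_floor_def)
next
  case False
  let ?a = "\<lfloor>log 2 v\<rfloor>" and ?b = "\<lfloor>log 2 w\<rfloor>"
  have "?a \<le> ?b" using False assms by (intro floor_mono) simp
  then consider "?a = ?b" | "?a + 1 \<le> ?b" by linarith
  then show ?thesis
  proof cases
    case 2
    have "2 * 2 powr real_of_int ?a = (2::real) powr (1 + real_of_int ?a)" by (simp add: powr_add)
    also have "\<dots> \<le> 2 powr real_of_int ?b" using 2 by (intro powr_mono) linarith+
    finally show ?thesis using 2 False assms by (simp add: dyadic_floor_def)
  qed (use False assms in \<open>simp add: dyadic_floor_def\<close>)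
qed

section \<open>The grid algorithm\<close>

text \<open>With this \<open>K\<close> the cost \<open>n / K\<close> of following tags and the cost
  \<open>K * (1 + ln n)\<close> of starts both equal \<open>sqrt (n * (1 + ln n))\<close>. The
  summand 1 keeps the divisor positive at \<open>n = 1\<close>.\<close>

definition resolution :: "nat \<Rightarrow> real" where
  "resolution n = sqrt (real n / (1 + ln (real n)))"

text \<open>
  While all items coincide, \<open>\<tau> = 0\<close> and division by \<open>0\<close> puts every item into one grid cell.
\<close>

definition item_tag :: "nat \<Rightarrow> nat \<Rightarrow> (nat \<Rightarrow> real) list \<Rightarrow> real \<times> (nat \<Rightarrow> int)" where
  "item_tag d n xs =
     (let \<tau> = dyadic_floor (walk_inf (Rn_metric d) (set xs))
      in (\<tau>, grid_cell d (\<tau> / resolution n) (last xs)))"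

text \<open>The algorithm keeps no state: it replays the run on the revealed prefix, whose last item
  has index \<open>length xs - 1\<close>.\<close>

definition grid_alg :: "nat \<Rightarrow> (nat \<Rightarrow> real) online_alg" where
  "grid_alg d n xs = gap_cell n (\<lambda>j. item_tag d n (take (Suc j) xs)) (length xs - 1)"

abbreviation item_tags :: "nat \<Rightarrow> (nat \<Rightarrow> real) list \<Rightarrow> nat \<Rightarrow> real \<times> (nat \<Rightarrow> int)" where
  "item_tags d X j \<equiv> item_tag d (length X) (take (Suc j) X)"

lemma alg_cell_grid_alg:
  assumes "j < length X"
  shows "alg_cell (grid_alg d) X j = gap_cell (length X) (item_tags d X) j"
proof -
  have "gap_cell (length X) (\<lambda>i. item_tag d (length X) (take (Suc i) (take (Suc j) X))) j
      = gap_cell (length X) (item_tags d X) j"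
    by (rule gap_cell_cong) (simp add: min_def)
  moreover have "length (take (Suc j) X) - 1 = j" using assms by simp
  ultimately show ?thesis unfolding alg_cell_def grid_alg_def by metis
qed

lemma online_algorithm_grid_alg: "online_algorithm (Rn_metric d) (grid_alg d)"
  unfolding online_algorithm_def
proof (intro allI ballI impI conjI)
  fix n X j assume "X \<in> tsp_inputs (Rn_metric d) n" and j: "j < n"
  then have n: "n = length X" by (simp add: tsp_inputs_def)
  show "alg_cell (grid_alg d) X j < n"
    using alg_cell_grid_alg[of j X d] gap_run.cell_less[of j n "item_tags d X"] j n by simp
  fix k assume "k < j"
  then show "alg_cell (grid_alg d) X j \<noteq> alg_cell (grid_alg d) X k"
    using alg_cell_grid_alg[of j X d] alg_cell_grid_alg[of k X d]
      gap_run.cell_neq[of k j n "item_tags d X"] j n by simp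
qed

section \<open>Number of tags per scale and cost of the algorithm\<close>

lemma resolution_ge_1:
  assumes "0 < n" shows "1 \<le> resolution n"
proof -
  have "0 \<le> ln (real n)" using assms by simp
  moreover have "1 + ln (real n) \<le> real n" using ln_le_minus_one[of "real n"] assms by simp
  ultimately show ?thesis by (simp add: resolution_def)
qed

lemma last_take_Suc: "j < length X \<Longrightarrow> last (take (Suc j) X) = X ! j"
  by (simp add: take_Suc_conv_app_nth)

lemma nth_in_set_take_Suc: "i \<le> j \<Longrightarrow> j < length X \<Longrightarrow> X ! i \<in> set (take (Suc j) X)"
  by (auto simp: in_set_conv_nth intro!: exI[of _ i])

text \<open>All items of scale \<open>\<tau>\<close> lie in the prefix that ends with the last of
  them. This prefix has walk infimum at most \<open>2 * \<tau>\<close>, so it meets few grid cells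
  of width \<open>\<tau> / K\<close>.\<close>

lemma card_item_tags_le:
  assumes "X \<noteq> []"
  shows "real (card {item_tags d X j | j. j < length X \<and> fst (item_tags d X j) = \<tau>})
    \<le> 2 ^ d * (2 * resolution (length X) + 1)"
proof -
  let ?K = "resolution (length X)" and ?w = "\<lambda>j. walk_inf (Rn_metric d) (set (take (Suc j) X))"
  define J where "J = {j. j < length X \<and> fst (item_tags d X j) = \<tau>}"
  have K: "1 \<le> ?K" using resolution_ge_1 assms by simp
  have tag: "item_tags d X j = (\<tau>, grid_cell d (\<tau> / ?K) (X ! j))" if "j \<in> J" for j
    using that by (auto simp: J_def item_tag_def Let_def last_take_Suc)
  have eq: "{item_tags d X j | j. j < length X \<and> fst (item_tags d X j) = \<tau>} = item_tags d X ` J"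
    by (auto simp: J_def)
  show ?thesis
  proof (cases "J = {}")
    case True
    then show ?thesis unfolding eq using K by simp
  next
    case False
    have fin: "finite J" by (simp add: J_def)
    define m where "m = Max J"
    have m: "m \<in> J" using False fin by (simp add: m_def)
    let ?S = "set (take (Suc m) X)"
    have w: "dyadic_floor (?w m) = \<tau>" using m by (simp add: J_def item_tag_def Let_def)
    have \<tau>: "0 \<le> \<tau>" using w dyadic_floor_nonneg by blast
    have sub: "X ! j \<in> ?S" if "j \<in> J" for j
    proof -
      have "j \<le> m" "m < length X" using that fin m by (auto simp: m_def J_def)
      then show ?thesis by (rule nth_in_set_take_Suc)
    qed
    have "card (item_tags d X ` J) = card ((\<lambda>k. (\<tau>, k)) ` (\<lambda>j. grid_cell d (\<tau> / ?K) (X ! j)) ` J)"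
      using tag by (simp add: image_image cong: image_cong)
    also have "\<dots> = card ((\<lambda>j. grid_cell d (\<tau> / ?K) (X ! j)) ` J)"
      by (rule card_image) (simp add: inj_on_def)
    also have "\<dots> \<le> card (grid_cell d (\<tau> / ?K) ` ?S)"
      using sub by (intro card_mono) auto
    finally have card: "card (item_tags d X ` J) \<le> card (grid_cell d (\<tau> / ?K) ` ?S)" .
    have "real (card (grid_cell d (\<tau> / ?K) ` ?S)) \<le> 2 ^ d * (2 * ?K + 1)"
    proof (cases "\<tau> = 0")
      case True
      have "grid_cell d (\<tau> / ?K) ` ?S \<subseteq> {\<lambda>i\<in>{..<d}. 0}"
        using True by (auto simp: grid_cell_def)
      then have "card (grid_cell d (\<tau> / ?K) ` ?S) \<le> 1"
        using card_mono[of "{\<lambda>i\<in>{..<d}. 0::int}"] by fastforce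
      also have "real 1 \<le> 2 ^ d * (2 * ?K + 1)"
        using K mult_mono[of 1 "2 ^ d" 1 "2 * ?K + 1"] by simp
      finally show ?thesis by simp
    next
      case False
      then have "0 < \<tau> / ?K" using \<tau> K by simp
      then have "real (card (grid_cell d (\<tau> / ?K) ` ?S)) \<le> 2 ^ d * (?w m / (\<tau> / ?K) + 1)"
        by (intro card_grid_cells_le_walk_inf) auto
      also have "?w m \<le> 2 * \<tau>" using le_dyadic_floor[of "?w m"] w by simp
      then have "?w m / (\<tau> / ?K) \<le> 2 * \<tau> / (\<tau> / ?K)"
        using \<open>0 < \<tau> / ?K\<close> by (intro divide_right_mono) auto
      then have "2 ^ d * (?w m / (\<tau> / ?K) + 1) \<le> 2 ^ d * (2 * ?K + 1)"
        using False by (intro mult_left_mono) auto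
      finally show ?thesis .
    qed
    then show ?thesis unfolding eq using card by linarith
  qed
qed

lemma grid_alg_cost_le:
  assumes d: "1 \<le> d" and X: "X \<noteq> []"
  shows "alg_cost (Rn_metric d) (grid_alg d) X
    \<le> sqrt (real d) * 2 ^ d * (61 * sqrt (real (length X) * (1 + ln (real (length X)))))
       * tsp_opt (Rn_metric d) X"
proof -
  define n where "n = length X"
  define K where "K = resolution n"
  define c where "c = item_tags d X"
  define A where "A = filled_array X (gap_cell n c)"
  define w where "w j = walk_inf (Rn_metric d) (set (take (Suc j) X))" for j
  let ?dis = "mdist (Rn_metric d)"
  have n: "0 < n" using X by (simp add: n_def)
  have K: "1 \<le> K" using resolution_ge_1[OF n] by (simp add: K_def)
  have c: "c j = (dyadic_floor (w j), grid_cell d (dyadic_floor (w j) / K) (X ! j))" if "j < n" for j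
    using that by (simp add: c_def item_tag_def Let_def last_take_Suc K_def n_def w_def)
  have A: "A (gap_cell n c j) = X ! j" if "j < n" for j
    using that gap_run.cell_bij[of n c] inv_into_f_f[of "gap_cell n c" "{..<n}" j]
    by (simp add: A_def filled_array_def bij_betw_def n_def)
  have w_mono: "w i \<le> w j" if "i \<le> j" for i j
    unfolding w_def using that by (intro walk_inf_mono set_take_subset_set_take) auto
  have dist_w: "?dis (X ! i) (X ! j) \<le> 2 * dyadic_floor (w j)" if "i < j" "j < n" for i j
  proof -
    have "X ! i \<in> set (take (Suc j) X)" "X ! j \<in> set (take (Suc j) X)"
      using that by (auto simp: n_def intro: nth_in_set_take_Suc)
    then have "?dis (X ! i) (X ! j) \<le> w j" unfolding w_def by (intro dist_le_walk_inf) auto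
    then show ?thesis using le_dyadic_floor[of "w j"] by linarith
  qed
  interpret gap_run_cost n c ?dis A "2 ^ d * (2 * K + 1)" "sqrt (real d) / K"
  proof unfold_locales
    show "1 \<le> 2 ^ d * (2 * K + 1)"
      using K mult_mono[of 1 "2 ^ d" 1 "2 * K + 1"] by simp
    show "fst (c (Suc t)) = fst (c t) \<or> fst (c t) < fst (c (Suc t)) \<and> 2 * fst (c t) \<le> fst (c (Suc t))"
      if "Suc t < n" for t
      using that dyadic_floor_gap[OF w_mono, of t "Suc t"] by (simp add: c)
    show "?dis (A (gap_cell n c i)) (A (gap_cell n c j)) \<le> 2 * fst (c j)" if "i < j" "j < n" for i j
      using dist_w[OF that] that A[of i] A[of j] c[of j] by simp
    show "?dis (A (gap_cell n c i)) (A (gap_cell n c j)) \<le> sqrt (real d) / K * fst (c j)"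
      if "i < j" "j < n" "c i = c j" for i j
    proof (cases "dyadic_floor (w j) = 0")
      \<comment> \<open>At scale 0 the bound by twice the scale already gives distance 0.\<close>
      case True
      then show ?thesis using dist_w[OF that(1,2)] that A[of i] A[of j] c[of j] by simp
    next
      case False
      then have "0 < dyadic_floor (w j) / K" using dyadic_floor_nonneg[of "w j"] K by simp
      moreover have "grid_cell d (dyadic_floor (w j) / K) (X ! i) = grid_cell d (dyadic_floor (w j) / K) (X ! j)"
        using that c[of i] c[of j] by auto
      ultimately show ?thesis
        using dist_in_grid_cell[of "dyadic_floor (w j) / K" d "X ! i" "X ! j"] that A[of i] A[of j] c[of j]
        by simp
    qed
    show "real (card {c j |j. j < n \<and> fst (c j) = \<tau>}) \<le> 2 ^ d * (2 * K + 1)" for \<tau>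
      using card_item_tags_le[OF X, of d \<tau>] by (simp add: c_def n_def K_def)
    show "?dis x y = ?dis y x" for x y by (rule mdist_commute)
  qed (use n K c dyadic_floor_nonneg in auto)
  define H where "H = 1 + ln (real n)"
  define s where "s = sqrt (real n * H)"
  define \<tau> where "\<tau> = dyadic_floor (w (n - 1))"
  have H: "1 \<le> H" using n by (simp add: H_def)
  have s: "0 \<le> s" using H by (simp add: s_def)
  have nK: "real n / K = s"
    using n H by (simp add: K_def resolution_def s_def H_def[symmetric] real_sqrt_divide real_sqrt_mult
        real_div_sqrt field_simps)
  have KH: "K * H = s"
    using n H by (simp add: K_def resolution_def s_def H_def[symmetric] real_sqrt_divide real_sqrt_mult
        field_simps)
  have "A i = filled_array X (alg_cell (grid_alg d) X) i" if "i < n" for i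
  proof -
    \<comment> \<open>The two cell functions are known to agree only below \<open>n\<close>, which
      is all that \<open>inv_into\<close> looks at.\<close>
    have "inv_into {..<n} (gap_cell n c) i = inv_into {..<n} (alg_cell (grid_alg d) X) i"
      unfolding inv_into_def
      by (intro arg_cong[where f = Eps] ext) (auto simp: n_def c_def alg_cell_grid_alg)
    then show ?thesis by (simp add: A_def filled_array_def n_def)
  qed
  then have "alg_cost (Rn_metric d) (grid_alg d) X = (\<Sum>i<n - 1. ?dis (A i) (A (Suc i)))"
    by (simp add: alg_cost_def array_cost_def n_def)
  also have "\<dots> \<le> \<tau> * (real n * (sqrt (real d) / K) + 20 * (2 ^ d * (2 * K + 1)) * H)"
    using total_cost_le c[of "n - 1"] n by (simp add: \<tau>_def H_def)
  \<comment> \<open>61 is 1 for following tags plus \<open>20 * 3\<close> for starts, by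
    \<open>2 * K + 1 \<le> 3 * K\<close>; \<open>d \<ge> 1\<close> lets the second term absorb
    \<open>sqrt d\<close>.\<close>
  also have "\<dots> \<le> \<tau> * (sqrt (real d) * 2 ^ d * (61 * s))"
  proof (rule mult_left_mono)
    have "real n * (sqrt (real d) / K) = sqrt (real d) * s" by (simp add: nK[symmetric])
    also have "\<dots> \<le> sqrt (real d) * 2 ^ d * s"
      using s mult_left_mono[of 1 "2 ^ d" "sqrt (real d)"] by (intro mult_right_mono) auto
    finally have 1: "real n * (sqrt (real d) / K) \<le> sqrt (real d) * 2 ^ d * s" .
    have "20 * (2 ^ d * (2 * K + 1)) * H \<le> 20 * (2 ^ d * (3 * K)) * H"
      using K H by (intro mult_right_mono mult_left_mono) auto
    also have "\<dots> = 2 ^ d * (60 * s)" by (simp add: KH[symmetric])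
    also have "\<dots> \<le> sqrt (real d) * (2 ^ d * (60 * s))"
      using d s mult_right_mono[of 1 "sqrt (real d)" "2 ^ d * (60 * s)"] by simp
    finally show "real n * (sqrt (real d) / K) + 20 * (2 ^ d * (2 * K + 1)) * H
        \<le> sqrt (real d) * 2 ^ d * (61 * s)"
      using 1 by (simp add: algebra_simps)
  qed (simp add: \<tau>_def dyadic_floor_nonneg)
  also have "\<dots> \<le> tsp_opt (Rn_metric d) X * (sqrt (real d) * 2 ^ d * (61 * s))"
  proof (rule mult_right_mono)
    have "\<tau> \<le> walk_inf (Rn_metric d) (set X)"
      using dyadic_floor_le[OF walk_inf_nonneg[of "set X" "Rn_metric d"]] n by (simp add: \<tau>_def w_def n_def)
    then show "\<tau> \<le> tsp_opt (Rn_metric d) X" using walk_inf_le_tsp_opt[of "Rn_metric d" X] by simp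
  qed (use s in simp)
  finally show ?thesis by (simp add: s_def H_def n_def mult.commute)
qed

theorem theorem2:
  shows "\<exists>f :: nat \<Rightarrow> real. f \<in> O(\<lambda>n. sqrt (real n * ln (real n))) \<and>
    (\<forall>d\<ge>1. \<exists>alg. online_algorithm (Rn_metric d) alg \<and>
       (\<forall>n. competitive_ratio (Rn_metric d) alg n \<le> ereal (sqrt (real d) * 2 ^ d * f n)))"
proof (intro exI[of _ "\<lambda>n. 61 * sqrt (real n * (1 + ln (real n)))"] conjI allI impI)
  \<comment> \<open>From 3 on, \<open>ln n \<ge> 1\<close> and hence
    \<open>1 + ln n \<le> 2 * ln n\<close>.\<close>
  have "sqrt (real n * (1 + ln (real n))) \<le> sqrt 2 * sqrt (real n * ln (real n))" if "3 \<le> n" for n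
  proof -
    have "ln (exp 1) \<le> ln (real n)" using that exp_le by (intro ln_mono) auto
    then have "real n * (1 + ln (real n)) \<le> real n * (2 * ln (real n))"
      by (intro mult_left_mono) auto
    then have "sqrt (real n * (1 + ln (real n))) \<le> sqrt (2 * (real n * ln (real n)))"
      by (intro real_sqrt_le_mono) (simp add: mult.left_commute)
    then show ?thesis by (simp add: real_sqrt_mult)
  qed
  then show "(\<lambda>n. 61 * sqrt (real n * (1 + ln (real n)))) \<in> O(\<lambda>n. sqrt (real n * ln (real n)))"
    by (intro bigoI[of _ "61 * sqrt 2"] eventually_sequentiallyI[of 3]) (auto simp: abs_mult)
next
  fix d :: nat assume d: "1 \<le> d"
  let ?R = "\<lambda>n. sqrt (real d) * 2 ^ d * (61 * sqrt (real n * (1 + ln (real n))))"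
  have "ereal (alg_cost (Rn_metric d) (grid_alg d) X) / ereal (tsp_opt (Rn_metric d) X) \<le> ereal (?R n)"
    if "X \<in> tsp_inputs (Rn_metric d) n" for n X
  proof -
    let ?c = "alg_cost (Rn_metric d) (grid_alg d) X" and ?o = "tsp_opt (Rn_metric d) X"
    have n: "n = length X" using that by (simp add: tsp_inputs_def)
    have R: "0 \<le> ?R n" by (cases "n = 0") auto
    have o: "0 \<le> ?o"
      using walk_inf_nonneg[of "set X" "Rn_metric d"] walk_inf_le_tsp_opt[of "Rn_metric d" X] by simp
    have c0: "0 \<le> ?c" by (simp add: alg_cost_def array_cost_nonneg)
    have c: "?c \<le> ?R n * ?o"
    proof (cases "X = []")
      case True
      then show ?thesis using R o n by (simp add: alg_cost_def array_cost_def)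
    next
      case False
      then show ?thesis using grid_alg_cost_le[OF d False] n by simp
    qed
    show ?thesis
    proof (cases "?o = 0")
      \<comment> \<open>The cost vanishes as well, and \<open>0 / 0 = 0\<close> in
        \<open>ereal\<close>.\<close>
      case True
      then have "?c = 0" using c c0 by simp
      then show ?thesis using True R by simp
    next
      case False
      then have "?c / ?o \<le> ?R n" using c o by (simp add: pos_divide_le_eq)
      then show ?thesis using False by simp
    qed
  qed
  then have "competitive_ratio (Rn_metric d) (grid_alg d) n \<le> ereal (?R n)" for n
    unfolding competitive_ratio_def by (intro SUP_least) blast
  then show "\<exists>alg. online_algorithm (Rn_metric d) alg \<and>
      (\<forall>n. competitive_ratio (Rn_metric d) alg n \<le> ereal (?R n))"
    using online_algorithm_grid_alg by blast
qed

end
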